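(* Let $[\mu]\in L_n$ be a critical point of $F_n$ of type $(0<k_2<\dots<k_r;d_1,\dots,d_r)$, and let $\mathbb{C}^n=\mathfrak{g}_1\oplus\mathfrak{g}_2\oplus\dots\oplus\mathfrak{g}_r$ be the eigenspace decomposition of $M_\mu=c_\mu I+D_\mu$, with $\mathfrak{g}_i$ the eigenspace of $D_\mu$ corresponding to $k_i$ (where $k_1=0$). Write $\mathfrak{n}=\mathfrak{g}_2\oplus\dots\oplus\mathfrak{g}_r$, and $\mathfrak{g}_1=\mathfrak{h}\oplus\mathfrak{a}$ with $\mathfrak{h}$ semisimple and $\mathfrak{a}$ the center of the (reductive) Lie algebra $\mathfrak{g}_1$. Then: (i) $\mathrm{ad}_\mu A$ is a normal operator for every $A\in\mathfrak{a}$. (ii) The real subalgebra $\mathfrak{k}=\{A\in\mathfrak{h}:(\mathrm{ad}_\mu A)^*=-\mathrm{ad}_\mu A\}$ is a maximal compact subalgebra of $\mathfrak{h}$, that is, $\mathfrak{h}=\mathfrak{k}+\mathrm{i}\mathfrak{k}$. (iii) The hermitian inner product on $\mathfrak{g}_1$ satisfies $$\langle A,B\rangle=-\frac{4}{c_\mu}\left(\tfrac12\,\mathrm{tr}\,\mathrm{ad}_\mu A(\mathrm{ad}_\mu B)^*|_{\mathfrak{h}}+\mathrm{tr}\,\mathrm{ad}_\mu A(\mathrm{ad}_\mu B)^*|_{\mathfrak{n}}\right),\qquad A,B\in\mathfrak{g}_1.$$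
   Context: Let $V_n=\Lambda^2(\mathbb{C}^n)^*\otimes\mathbb{C}^n$ be the space of alternating bilinear maps $\mathbb{C}^n\times\mathbb{C}^n\to\mathbb{C}^n$. Fix the usual hermitian inner product $\langle\cdot,\cdot\rangle$ on $\mathbb{C}^n$; ${}^*$ is the adjoint with respect to it. On $V_n$ use $\langle\mu,\lambda\rangle=\sum_{i,j,k}\langle\mu(X_i,X_j),X_k\rangle\overline{\langle\lambda(X_i,X_j),X_k\rangle}$, $\{X_i\}$ any orthonormal basis of $\mathbb{C}^n$. For $\mu\in V_n$, let $\mathrm{ad}_\mu X(Y)=\mu(X,Y)$, let $\mathrm{Der}(\mu)$ be the space of derivations of $(\mathbb{C}^n,\mu)$, and $$M_\mu=-4\sum_i(\mathrm{ad}_\mu X_i)^*\mathrm{ad}_\mu X_i+2\sum_i\mathrm{ad}_\mu X_i(\mathrm{ad}_\mu X_i)^*,$$ a hermitian operator on $\mathbb{C}^n$. $\mathbb{P}V_n$ is the projective space of $V_n$, $[\mu]$ the class of $\mu\neq0$, and $F_n:\mathbb{P}V_n\to\mathbb{R}$ is $F_n([\mu])=\mathrm{tr}\,M_\mu^2$ for $\|\mu\|=1$. $L_n\subset\mathbb{P}V_n$ is the set of $[\mu]$ with $\mu\ne0$ satisfying the Jacobi identity. It is known that $[\mu]$ is a critical point of $F_n$ on $\mathbb{P}V_n$ if and only if $M_\mu=c_\mu I+D_\mu$ with $c_\mu\in\mathbb{R}$, $D_\mu\in\mathrm{Der}(\mu)$, and that then some positive multiple of $D_\mu$ has as eigenvalues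 nonnegative integers $k_1<\dots<k_r$ with no common factor ($k_1=0$, $r=1$ if $D_\mu=0$), with multiplicities $d_1,\dots,d_r$; $(k_1<\dots<k_r;d_1,\dots,d_r)$ is the type of $[\mu]$. When $k_1=0$, it is known that $\mathfrak{g}_1$ is a reductive subalgebra of $\mu$ and that $\mathfrak{n}$ is the nilradical of $\mu$. *)

theory Defs
  imports "HOL-Analysis.Analysis"
begin

section \<open>Hermitian linear algebra on the space of complex column vectors\<close>

text \<open>
  Operators are given by their matrices in the standard basis, which is orthonormal.
\<close>

definition herm :: "complex ^ 'n \<Rightarrow> complex ^ 'n \<Rightarrow> complex" where
  "herm x y = (\<Sum>i\<in>UNIV. x $ i * cnj (y $ i))"

definition adj :: "complex ^ 'n ^ 'n \<Rightarrow> complex ^ 'n ^ 'n" where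
  "adj A = (\<chi> i j. cnj (A $ j $ i))"

lemma herm_adj: "herm (A *v x) y = herm x (adj A *v y)"
proof -
  have "herm (A *v x) y = (\<Sum>i\<in>UNIV. \<Sum>j\<in>UNIV. A $ i $ j * x $ j * cnj (y $ i))"
    by (simp add: herm_def matrix_vector_mult_def sum_distrib_right)
  also have "\<dots> = (\<Sum>j\<in>UNIV. \<Sum>i\<in>UNIV. A $ i $ j * x $ j * cnj (y $ i))"
    by (rule sum.swap)
  also have "\<dots> = herm x (adj A *v y)"
    by (simp add: herm_def adj_def matrix_vector_mult_def sum_distrib_left mult_ac)
  finally show ?thesis .
qed

definition eigenspace :: "complex ^ 'n ^ 'n \<Rightarrow> complex \<Rightarrow> (complex ^ 'n) set" where
  "eigenspace T z = {x. T *v x = z *s x}"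

text \<open>
  The trace of the restriction of \<open>T\<close> to a \<open>T\<close>-invariant complex subspace \<open>S\<close>,
  computed in a basis of \<open>S\<close>.  It is meaningful only if \<open>T\<close> maps \<open>S\<close> into itself.
\<close>

definition trace_on :: "(complex ^ 'n) set \<Rightarrow> complex ^ 'n ^ 'n \<Rightarrow> complex" where
  "trace_on S T =
     (let B = (SOME B. vec.independent B \<and> vec.span B = S)
      in \<Sum>b\<in>B. vec.representation B (T *v b) b)"

section \<open>Alternating bilinear maps and the operator \<open>M\<close>\<close>

type_synonym 'n bracket = "complex ^ 'n \<Rightarrow> complex ^ 'n \<Rightarrow> complex ^ 'n"

definition Vn :: "'n::finite bracket set" where
  "Vn = {\<mu>. (\<forall>x. Vector_Spaces.linear (*s) (*s) (\<mu> x)) \<and>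
            (\<forall>y. Vector_Spaces.linear (*s) (*s) (\<lambda>x. \<mu> x y)) \<and>
            (\<forall>x. \<mu> x x = 0)}"

definition V_inner :: "'n::finite bracket \<Rightarrow> 'n bracket \<Rightarrow> complex" where
  "V_inner \<mu> \<nu> = (\<Sum>i\<in>UNIV. \<Sum>j\<in>UNIV. \<Sum>k\<in>UNIV.
     herm (\<mu> (axis i 1) (axis j 1)) (axis k 1) *
     cnj (herm (\<nu> (axis i 1) (axis j 1)) (axis k 1)))"

definition V_norm :: "'n::finite bracket \<Rightarrow> real" where
  "V_norm \<mu> = sqrt (Re (V_inner \<mu> \<mu>))"

definition ad :: "'n::finite bracket \<Rightarrow> complex ^ 'n \<Rightarrow> complex ^ 'n ^ 'n" where
  "ad \<mu> x = matrix (\<mu> x)"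

definition Der :: "'n::finite bracket \<Rightarrow> (complex ^ 'n ^ 'n) set" where
  "Der \<mu> = {D. \<forall>x y. D *v \<mu> x y = \<mu> (D *v x) y + \<mu> x (D *v y)}"

definition M_op :: "'n::finite bracket \<Rightarrow> complex ^ 'n ^ 'n" where
  "M_op \<mu> =
     (- 4) *\<^sub>R (\<Sum>i\<in>UNIV. adj (ad \<mu> (axis i 1)) ** ad \<mu> (axis i 1)) +
     2 *\<^sub>R (\<Sum>i\<in>UNIV. ad \<mu> (axis i 1) ** adj (ad \<mu> (axis i 1)))"

definition jacobi :: "'n::finite bracket \<Rightarrow> bool" where
  "jacobi \<mu> \<longleftrightarrow> (\<forall>x y z. \<mu> x (\<mu> y z) + \<mu> y (\<mu> z x) + \<mu> z (\<mu> x y) = 0)"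

section \<open>The projective space and critical points\<close>

definition proj_class :: "'n::finite bracket \<Rightarrow> 'n bracket set" where
  "proj_class \<mu> = {\<lambda>x y. z *s \<mu> x y | z. z \<noteq> 0}"

definition PVn :: "'n::finite bracket set set" where
  "PVn = {proj_class \<mu> | \<mu>. \<mu> \<in> Vn \<and> \<mu> \<noteq> (\<lambda>x y. 0)}"

definition Lie_classes :: "'n::finite bracket set set" where
  "Lie_classes = {proj_class \<mu> | \<mu>. \<mu> \<in> Vn \<and> \<mu> \<noteq> (\<lambda>x y. 0) \<and> jacobi \<mu>}"

text \<open>
  The description is well defined on \<open>PVn\<close>: \<open>M_op\<close> is hermitian, so the trace is real, and two
  unit representatives differ by a phase, which \<open>M_op\<close> does not see.
\<close>

definition Fn :: "'n::finite bracket set \<Rightarrow> real" where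
  "Fn p = (THE r. \<exists>\<mu>\<in>p. V_norm \<mu> = 1 \<and> complex_of_real r = trace (M_op \<mu> ** M_op \<mu>))"

text \<open>
  The differential of a smooth function \<open>f\<close> on projective space vanishes at \<open>p = [\<mu>]\<close>.  Every
  tangent vector at \<open>p\<close> is the velocity at \<open>t = 0\<close> of a curve \<open>t \<mapsto> [\<mu> + t \<nu>]\<close> with
  \<open>\<nu>\<close> in \<open>Vn\<close>.
\<close>

definition critical_point :: "('n::finite bracket set \<Rightarrow> real) \<Rightarrow> 'n bracket set \<Rightarrow> bool" where
  "critical_point f p \<longleftrightarrow> p \<in> PVn \<and>
     (\<forall>\<mu>\<in>p. \<forall>\<nu>\<in>Vn.
        ((\<lambda>t::real. f (proj_class (\<lambda>x y. \<mu> x y + t *\<^sub>R \<nu> x y))) has_real_derivative 0) (at 0))"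

text \<open>
  \<open>E\<close> has exactly the eigenvalues \<open>k\<^sub>1 < \<dots> < k\<^sub>r\<close>, natural numbers without common factor, with
  multiplicities \<open>d\<^sub>1, \<dots>, d\<^sub>r\<close>.  This is applied to the positive multiple of the derivation
  that is normalized in this way (a hermitian operator, so geometric multiplicities suffice).
  The operator 0 has the list \<open>[0]\<close>, whose gcd is 0.
\<close>

definition eigenvalue_type :: "complex ^ 'n ^ 'n \<Rightarrow> nat list \<Rightarrow> nat list \<Rightarrow> bool" where
  "eigenvalue_type E ks ds \<longleftrightarrow>
     length ds = length ks \<and> sorted_wrt (<) ks \<and> (Gcd (set ks) = 1 \<or> ks = [0]) \<and>
     {z. \<exists>v. v \<noteq> 0 \<and> E *v v = z *s v} = of_nat ` set ks \<and>
     (\<forall>i<length ks. vec.dim (eigenspace E (of_nat (ks ! i))) = ds ! i)"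

section \<open>Complex subalgebras of a bracket\<close>

definition subalgebra :: "'n::finite bracket \<Rightarrow> (complex ^ 'n) set \<Rightarrow> bool" where
  "subalgebra \<mu> \<hh> \<longleftrightarrow> vec.subspace \<hh> \<and> (\<forall>x\<in>\<hh>. \<forall>y\<in>\<hh>. \<mu> x y \<in> \<hh>)"

definition ideal_of :: "'n::finite bracket \<Rightarrow> (complex ^ 'n) set \<Rightarrow> (complex ^ 'n) set \<Rightarrow> bool" where
  "ideal_of \<mu> J \<hh> \<longleftrightarrow> vec.subspace J \<and> J \<subseteq> \<hh> \<and> (\<forall>x\<in>\<hh>. \<forall>y\<in>J. \<mu> x y \<in> J)"

definition derived :: "'n::finite bracket \<Rightarrow> (complex ^ 'n) set \<Rightarrow> (complex ^ 'n) set" where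
  "derived \<mu> S = vec.span {\<mu> x y | x y. x \<in> S \<and> y \<in> S}"

definition solvable :: "'n::finite bracket \<Rightarrow> (complex ^ 'n) set \<Rightarrow> bool" where
  "solvable \<mu> S \<longleftrightarrow> (\<exists>m. (derived \<mu> ^^ m) S = {0})"

definition semisimple :: "'n::finite bracket \<Rightarrow> (complex ^ 'n) set \<Rightarrow> bool" where
  "semisimple \<mu> \<hh> \<longleftrightarrow> subalgebra \<mu> \<hh> \<and> (\<forall>J. ideal_of \<mu> J \<hh> \<and> solvable \<mu> J \<longrightarrow> J = {0})"

definition center :: "'n::finite bracket \<Rightarrow> (complex ^ 'n) set \<Rightarrow> (complex ^ 'n) set" where
  "center \<mu> \<gg> = {x\<in>\<gg>. \<forall>y\<in>\<gg>. \<mu> x y = 0}"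

section \<open>Real subalgebras and compactness\<close>

definition real_subalgebra :: "'n::finite bracket \<Rightarrow> (complex ^ 'n) set \<Rightarrow> bool" where
  "real_subalgebra \<mu> \<kk> \<longleftrightarrow> subspace \<kk> \<and> (\<forall>x\<in>\<kk>. \<forall>y\<in>\<kk>. \<mu> x y \<in> \<kk>)"

text \<open>
  A real Lie algebra is compact iff it carries an ad-invariant real inner product.  The form
  \<open>Q\<close> is a bilinear form on the ambient real space, but only its restriction to \<open>\<kk>\<close> matters.
\<close>

definition compact_subalgebra :: "'n::finite bracket \<Rightarrow> (complex ^ 'n) set \<Rightarrow> bool" where
  "compact_subalgebra \<mu> \<kk> \<longleftrightarrow> real_subalgebra \<mu> \<kk> \<and>
     (\<exists>Q :: complex ^ 'n \<Rightarrow> complex ^ 'n \<Rightarrow> real. bilinear Q \<and>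
        (\<forall>x\<in>\<kk>. \<forall>y\<in>\<kk>. Q x y = Q y x) \<and>
        (\<forall>x\<in>\<kk>. x \<noteq> 0 \<longrightarrow> Q x x > 0) \<and>
        (\<forall>x\<in>\<kk>. \<forall>y\<in>\<kk>. \<forall>z\<in>\<kk>. Q (\<mu> x y) z = - Q y (\<mu> x z)))"

definition maximal_compact_subalgebra ::
    "'n::finite bracket \<Rightarrow> (complex ^ 'n) set \<Rightarrow> (complex ^ 'n) set \<Rightarrow> bool" where
  "maximal_compact_subalgebra \<mu> \<kk> \<hh> \<longleftrightarrow> compact_subalgebra \<mu> \<kk> \<and> \<kk> \<subseteq> \<hh> \<and>
     (\<forall>\<kk>'. compact_subalgebra \<mu> \<kk>' \<and> \<kk> \<subseteq> \<kk>' \<and> \<kk>' \<subseteq> \<hh> \<longrightarrow> \<kk>' = \<kk>)"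

end

theory Submission
  imports Defs
begin

text \<open>
  Up to scaling, \<open>M_op\<close> is the moment map of the action of matrices on brackets, so for a
  derivation \<open>E\<close> commuting with \<open>D\<close> the squared norm of the action of \<open>E\<^sup>*\<close> on \<open>\<mu>\<close> is half of
  \<open>tr (M_op \<mu> [E, E\<^sup>*]) = tr ([D, E] E\<^sup>*) = 0\<close>; hence \<open>E\<^sup>*\<close> is a derivation as well.
  Applied to \<open>E = ad A\<close> with \<open>D A = 0\<close>, this makes the center of \<open>ker D\<close> the orthogonal complement of
  \<open>[ker D, ker D]\<close>, so \<open>\<hh> = [\<hh>, \<hh>]\<close> is orthogonal to \<open>\<aa>\<close>, and \<open>[(ad A)\<^sup>*, ad A] = ad ((ad A)\<^sup>* A)\<close>
  vanishes for central \<open>A\<close>.  Moreover \<open>ad \<hh>\<close> is stable under commutators with its adjoints, and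
  being perfect it is then closed under adjoints: \<open>(ad A)\<^sup>* = ad (star A)\<close> for a conjugate linear
  involution \<open>star\<close> of \<open>\<hh>\<close>, which gives \<open>\<hh> = \<kk> + \<i>\<kk>\<close>.  Finally the inner product formula is
  \<open>c \<langle>A, B\<rangle> = \<langle>M_op \<mu> A, B\<rangle>\<close> written out, where the second sum in \<open>M_op\<close> becomes a trace over \<open>\<hh>\<close>
  because \<open>star\<close> is antiunitary.
\<close>

section \<open>Hermitian matrices and traces\<close>

lemma herm_simps:
  "herm (x + y) z = herm x z + herm y z"
  "herm x (y + z) = herm x y + herm x z"
  "herm (x - y) z = herm x z - herm y z"
  "herm x (y - z) = herm x y - herm x z"
  "herm (- x) z = - herm x z"
  "herm x (- z) = - herm x z"
  "herm (a *s x) z = a * herm x z"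
  "herm x (a *s z) = cnj a * herm x z"
  "herm 0 z = 0"
  "herm x 0 = 0"
  for x y z :: "complex ^ 'n"
  by (simp_all add: herm_def algebra_simps sum.distrib sum_subtractf sum_negf sum_distrib_left)

lemma herm_cnj: "cnj (herm x y) = herm y x" for x y :: "complex ^ 'n"
  by (simp add: herm_def mult.commute)

text \<open>Bridge to the real inner product, so that the library's orthogonal decompositions and
  compactness arguments apply.\<close>

lemma Re_herm: "Re (herm x y) = inner x y" for x y :: "complex ^ 'n"
  by (simp add: herm_def inner_vec_def inner_complex_def)

lemma herm_self_eq_0 [simp]: "herm x x = 0 \<longleftrightarrow> x = 0" for x :: "complex ^ 'n"
proof
  assume "herm x x = 0"
  then have "inner x x = 0" by (metis Re_herm zero_complex.sel(1))
  then show "x = 0" by simp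
qed (simp add: herm_def)

lemma herm_adj_right: "herm x (A *v y) = herm (adj A *v x) y" for A :: "complex ^ 'n ^ 'n"
  by (metis herm_adj herm_cnj)

lemma herm_sum:
  "herm (\<Sum>i\<in>I. f i) y = (\<Sum>i\<in>I. herm (f i) y)"
  "herm y (\<Sum>i\<in>I. f i) = (\<Sum>i\<in>I. herm y (f i))"
  for y :: "complex ^ 'n"
  by (induction I rule: infinite_finite_induct; simp add: herm_simps)+

lemma herm_axis: "herm x (axis i 1) = x $ i" for x :: "complex ^ 'n"
  by (simp add: herm_def axis_def if_distrib cong: if_cong)

lemma herm_Parseval: "(\<Sum>i\<in>UNIV. herm x (axis i 1) * cnj (herm y (axis i 1))) = herm x y"
  for x y :: "complex ^ 'n"
  by (simp add: herm_axis) (simp add: herm_def)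

lemma vec_eqI_herm: "(\<And>z. herm x z = herm y z) \<Longrightarrow> x = y" for x y :: "complex ^ 'n"
  by (metis herm_axis vec_eq_iff)

lemma adj_adj [simp]: "adj (adj A) = A"
  by (simp add: adj_def vec_eq_iff)

lemma adj_simps:
  "adj (A + B) = adj A + adj B"
  "adj (A - B) = adj A - adj B"
  "adj (- A) = - adj A"
  "adj (r *\<^sub>R A) = r *\<^sub>R adj A"
  "adj (0 :: complex ^ 'n ^ 'n) = 0"
  for A B :: "complex ^ 'n ^ 'n"
  by (simp_all add: adj_def vec_eq_iff)

lemma adj_mult: "adj (A ** B) = adj B ** adj A" for A B :: "complex ^ 'n ^ 'n"
  by (simp add: adj_def vec_eq_iff matrix_matrix_mult_def mult.commute)

lemma adj_sum: "adj (\<Sum>i\<in>I. f i) = (\<Sum>i\<in>I. adj (f i :: complex ^ 'n ^ 'n))"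
  by (induction I rule: infinite_finite_induct; simp add: adj_simps)

lemma adj_mat_of_real: "adj (mat (complex_of_real c) :: complex ^ 'n ^ 'n) = mat (complex_of_real c)"
  by (simp add: adj_def mat_def vec_eq_iff)

lemma trace_eq_herm: "trace A = (\<Sum>i\<in>UNIV. herm (A *v axis i 1) (axis i 1))"
  for A :: "complex ^ 'n ^ 'n"
  by (simp add: trace_def herm_axis) (simp add: matrix_vector_mult_def axis_def if_distrib cong: if_cong)

lemma inner_matrix: "inner A B = Re (trace (A ** adj B))" for A B :: "complex ^ 'n ^ 'n"
  by (simp add: trace_def adj_def matrix_matrix_mult_def inner_vec_def inner_complex_def)

section \<open>Commutators and their interplay with adjoints\<close>

definition commutator :: "complex ^ 'n ^ 'n \<Rightarrow> complex ^ 'n ^ 'n \<Rightarrow> complex ^ 'n ^ 'n" where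
  "commutator A B = A ** B - B ** A"

lemma matrix_mult_simps:
  "(A + B) ** C = A ** C + B ** C"
  "C ** (A + B) = C ** A + C ** B"
  "(A - B) ** C = A ** C - B ** C"
  "C ** (A - B) = C ** A - C ** B"
  "(- A) ** C = - (A ** C)"
  "C ** (- A) = - (C ** A)"
  "C ** 0 = 0" "0 ** C = 0"
  "(A ** B) ** C = A ** (B ** C)"
  for A B C :: "complex ^ 'n ^ 'n"
  by (simp_all add: matrix_mul_assoc)
    (simp_all add: vec_eq_iff matrix_matrix_mult_def algebra_simps sum.distrib sum_subtractf sum_negf)

lemma commutator_simps:
  "commutator (A + B) C = commutator A C + commutator B C"
  "commutator C (A + B) = commutator C A + commutator C B"
  "commutator A B = - commutator B A"
  by (simp_all add: commutator_def matrix_mult_simps algebra_simps)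

lemma adj_commutator: "adj (commutator A B) = commutator (adj B) (adj A)"
  by (simp add: commutator_def adj_simps adj_mult)

lemma commutator_jacobi:
  "commutator A (commutator B C) = commutator (commutator A B) C + commutator B (commutator A C)"
  by (simp add: commutator_def matrix_mult_simps)

lemma trace_commutator: "trace (commutator A B ** C) = trace (A ** commutator B C)"
proof -
  have "trace (B ** (A ** C)) = trace (A ** (C ** B))"
    by (metis matrix_mul_assoc trace_mul_sym)
  then show ?thesis
    by (simp add: commutator_def matrix_mult_simps trace_sub)
qed

text \<open>Let \<open>R\<close> be the largest adjoint-stable part of \<open>P\<close>. It contains
  every commutator of an element of \<open>P\<close> with an element of \<open>R\<close> or with the
  adjoint of an element of \<open>P\<close>. Elements of \<open>P\<close> orthogonal to
  \<open>R\<close> turn out to commute with each other, so every commutator of \<open>P\<close>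
  already lies in \<open>R\<close>.\<close>

lemma subspace_adj_commutator:
  fixes P :: "(complex ^ 'n ^ 'n) set"
  assumes P: "subspace P"
    and closed: "\<And>X Y. X \<in> P \<Longrightarrow> Y \<in> P \<Longrightarrow> commutator X (adj Y) \<in> P"
    and X: "X \<in> P" and Y: "Y \<in> P"
  shows "adj (commutator X Y) \<in> P"
proof -
  define R where "R = {X \<in> P. adj X \<in> P}"
  have R: "subspace R"
    using P by (auto simp: R_def subspace_def adj_simps)
  have comm_R: "commutator U (adj V) \<in> R" if "U \<in> P" "V \<in> P" for U V
    using that closed by (auto simp: R_def adj_commutator)
  have comm_R': "commutator U V \<in> R" if "U \<in> P" "V \<in> R" for U V
    using comm_R[of U "adj V"] that by (auto simp: R_def)
  have decomp: "\<exists>U V. Z = U + V \<and> U \<in> R \<and> V \<in> P \<and> (\<forall>W\<in>R. inner V W = 0)" if "Z \<in> P" for Z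
  proof -
    obtain U V where UV: "U \<in> span R" "\<And>W. W \<in> span R \<Longrightarrow> orthogonal V W" "Z = U + V"
      using orthogonal_subspace_decomp_exists[of R Z] by metis
    moreover have R_span: "span R = R" using R by simp
    ultimately have "V = Z - U" "U \<in> R" by simp_all
    moreover from this have "V \<in> P" using that P by (auto simp: R_def subspace_diff)
    ultimately show ?thesis using UV(2,3) unfolding R_span orthogonal_def by blast
  qed
  have adj_comm_0: "commutator U (adj V) = 0"
    if "U \<in> P" "V \<in> P" "\<forall>W\<in>R. inner U W = 0" for U V
  proof -
    let ?C = "commutator U (adj V)"
    have C: "?C \<in> R" using comm_R that by blast
    then have "commutator V ?C \<in> R" using that comm_R' by blast
    then have "commutator ?C V \<in> R" using R by (metis commutator_simps(3) subspace_neg)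
    moreover have "trace (?C ** adj ?C) = trace (U ** adj (commutator ?C V))"
      by (simp add: trace_commutator adj_commutator)
    ultimately have "inner ?C ?C = 0"
      using that by (simp add: inner_matrix)
    then show ?thesis by simp
  qed
  have comm_0: "commutator U V = 0"
    if "U \<in> P" "V \<in> P" "\<forall>W\<in>R. inner U W = 0" "\<forall>W\<in>R. inner V W = 0" for U V
  proof -
    let ?C = "commutator U V"
    have "commutator V (adj ?C) = 0"
    proof -
      have "commutator V (adj ?C) = commutator (commutator V (adj V)) (adj U) +
          commutator (adj V) (commutator V (adj U))"
        unfolding adj_commutator by (rule commutator_jacobi)
      also have "\<dots> = 0" using adj_comm_0 that by (simp add: commutator_def matrix_mult_simps)
      finally show ?thesis .
    qed
    then have "inner ?C ?C = 0"
      by (simp add: inner_matrix trace_commutator matrix_mult_simps) (simp add: trace_def)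
    then show ?thesis by simp
  qed
  obtain X1 X2 where X12: "X = X1 + X2" "X1 \<in> R" "X2 \<in> P" "\<forall>W\<in>R. inner X2 W = 0"
    using decomp X by metis
  obtain Y1 Y2 where Y12: "Y = Y1 + Y2" "Y1 \<in> R" "Y2 \<in> P" "\<forall>W\<in>R. inner Y2 W = 0"
    using decomp Y by metis
  \<comment> \<open>The term \<open>commutator X2 Y2\<close> is zero, and each remaining term has a
    factor in \<open>R\<close>.\<close>
  have "commutator X Y = - commutator Y X1 + commutator X2 Y1"
    using comm_0[of X2 Y2] X12 Y12 commutator_simps(3)[of Y X1] by (simp add: commutator_simps(1,2))
  moreover have "\<dots> \<in> R"
    using X12 Y12 Y comm_R' R by (intro subspace_add subspace_neg) auto
  ultimately show ?thesis by (simp add: R_def)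
qed

section \<open>Orthogonal complements, projections, restricted traces and eigenvectors\<close>

lemma scaleR_vec_complex: "r *\<^sub>R x = complex_of_real r *s x" for x :: "complex ^ 'n"
  unfolding vec_eq_iff by (simp add: complex_eq_iff)

lemma subspace_of_vec_subspace: "vec.subspace S \<Longrightarrow> subspace S" for S :: "(complex ^ 'n) set"
  by (auto simp: vec.subspace_def subspace_def scaleR_vec_complex)

definition orth_compl :: "(complex ^ 'n) set \<Rightarrow> (complex ^ 'n) set" where
  "orth_compl S = {x. \<forall>s\<in>S. herm x s = 0}"

lemma orth_complD: "x \<in> orth_compl S \<Longrightarrow> s \<in> S \<Longrightarrow> herm x s = 0"
  "x \<in> orth_compl S \<Longrightarrow> s \<in> S \<Longrightarrow> herm s x = 0"
  by (auto simp: orth_compl_def) (metis complex_cnj_zero herm_cnj)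

lemma subspace_orth_compl: "vec.subspace (orth_compl S)"
  by (auto simp: orth_compl_def vec.subspace_def herm_simps)

lemma orth_decomposition:
  assumes S: "vec.subspace S"
  obtains y where "y \<in> S" "x - y \<in> orth_compl S"
proof -
  obtain y z where yz: "y \<in> span S" "\<And>w. w \<in> span S \<Longrightarrow> orthogonal z w" "x = y + z"
    using orthogonal_subspace_decomp_exists[of S x] by metis
  have span: "span S = S" using subspace_of_vec_subspace[OF S] by simp
  have "herm z w = 0" if "w \<in> S" for w
  proof -
    \<comment> \<open>Real orthogonality suffices because a complex subspace also contains
      \<open>\<i> *s w\<close>, which tests the imaginary part.\<close>
    have "Re (herm z w) = 0" "Re (herm z (\<i> *s w)) = 0"
      using yz(2) that S span by (auto simp: Re_herm orthogonal_def vec.subspace_def)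
    then show ?thesis by (simp add: complex_eq_iff herm_simps)
  qed
  then show ?thesis using that[of y] yz span by (simp add: orth_compl_def)
qed

text \<open>Self-adjointness makes this the orthogonal projection; the matrix form allows traces
  over \<open>S\<close> to be written as \<open>trace (T ** P)\<close>.\<close>

definition is_projection :: "complex ^ 'n ^ 'n \<Rightarrow> (complex ^ 'n) set \<Rightarrow> bool" where
  "is_projection P S \<longleftrightarrow> adj P = P \<and> (\<forall>x. P *v x \<in> S) \<and> (\<forall>x\<in>S. P *v x = x)"

lemma projection_exists:
  fixes S :: "(complex ^ 'n) set"
  assumes S: "vec.subspace S"
  obtains P where "is_projection P S"
proof -
  obtain f where f: "\<And>x. f x \<in> S" "\<And>x. x - f x \<in> orth_compl S"
  proof -
    have "\<exists>y. y \<in> S \<and> x - y \<in> orth_compl S" for x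
      using orth_decomposition[OF S, of x] by blast
    then show ?thesis using that by metis
  qed
  have uniq: "f x = y" if "y \<in> S" "x - y \<in> orth_compl S" for x y
  proof -
    have "(x - y) - (x - f x) \<in> orth_compl S"
      using that f subspace_orth_compl by (metis vec.subspace_diff)
    moreover have "f x - y \<in> S" using that f S by (metis vec.subspace_diff)
    ultimately show ?thesis using orth_complD[of "f x - y" S "f x - y"] by simp
  qed
  have lin: "Vector_Spaces.linear (*s) (*s) f"
  proof (unfold_locales, goal_cases)
    case (1 x y)
    have "(x - f x) + (y - f y) \<in> orth_compl S"
      using f subspace_orth_compl by (metis vec.subspace_add)
    then show ?case using f S by (intro uniq) (auto simp: vec.subspace_add algebra_simps)
  next
    case (2 a x)
    have "a *s (x - f x) \<in> orth_compl S"
      using f subspace_orth_compl by (metis vec.subspace_scale)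
    then show ?case using f S by (intro uniq) (auto simp: vec.subspace_scale vec.scale_right_diff_distrib)
  qed
  have mf: "matrix f *v x = f x" for x
    using lin by (rule matrix_works)
  have "herm (f x) y = herm x (f y)" for x y
  proof -
    have "herm (f x) (y - f y) = 0" "herm (x - f x) (f y) = 0"
      using f orth_complD by metis+
    then show ?thesis by (simp add: herm_simps)
  qed
  then have "adj (matrix f) *v x = matrix f *v x" for x
    by (intro vec_eqI_herm) (metis herm_adj_right mf)
  then have "adj (matrix f) = matrix f"
    by (simp add: matrix_eq)
  moreover have "f x = x" if "x \<in> S" for x
    using that by (intro uniq) (auto simp: orth_compl_def herm_simps)
  ultimately have "is_projection (matrix f) S"
    using f by (simp add: is_projection_def mf)
  then show ?thesis by (rule that)
qed

lemma projection_orth_compl: "is_projection P S \<Longrightarrow> x \<in> orth_compl S \<Longrightarrow> P *v x = 0"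
  by (metis herm_adj herm_self_eq_0 is_projection_def orth_complD(1))

text \<open>Invariance under \<open>T\<close> gives \<open>P ** T ** P = T ** P\<close>; invariance
  under \<open>adj T\<close>, after taking adjoints, gives
  \<open>P ** T ** P = P ** T\<close>.\<close>

lemma projection_commute:
  assumes "is_projection P S" "\<And>x. x \<in> S \<Longrightarrow> T *v x \<in> S" "\<And>x. x \<in> S \<Longrightarrow> adj T *v x \<in> S"
  shows "P ** T = T ** P"
proof -
  have P: "adj P = P" "\<And>x. P *v x \<in> S" "\<And>x. x \<in> S \<Longrightarrow> P *v x = x"
    using assms(1) by (auto simp: is_projection_def)
  have "P ** T ** P = T ** P" "P ** adj T ** P = adj T ** P"
    using P assms by (auto simp: matrix_eq simp flip: matrix_vector_mul_assoc)
  then show ?thesis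
    using P(1) by (metis adj_adj adj_mult matrix_mul_assoc)
qed

text \<open>The basis chosen by \<open>SOME\<close> drops out: expanding each
  \<open>P *v axis i 1\<close> in it and interchanging the sums turns the matrix trace into the sum
  of diagonal coordinates.\<close>

lemma trace_on_eq:
  fixes S :: "(complex ^ 'n) set"
  assumes S: "vec.subspace S" and P: "is_projection P S"
    and T: "\<And>x. x \<in> S \<Longrightarrow> T *v x \<in> S"
  shows "trace_on S T = trace (T ** P)"
proof -
  define B where "B = (SOME B. vec.independent B \<and> vec.span B = S)"
  have "\<exists>B. vec.independent B \<and> vec.span B = S"
    using vec.basis_exists[of S] S by (metis subset_antisym vec.span_minimal)
  then have B: "vec.independent B" "vec.span B = S"
    unfolding B_def by (metis (mono_tags, lifting) someI_ex)+
  have fin: "finite B" using B(1) by (rule vec.finiteI_independent)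
  let ?r = "vec.representation B"
  have PS: "P *v x \<in> S" "x \<in> S \<Longrightarrow> P *v x = x" for x using P by (auto simp: is_projection_def)
  have r: "(\<Sum>b\<in>B. ?r x b *s b) = x" if "x \<in> S" for x
    using vec.sum_representation_eq[OF B(1) _ fin subset_refl] that B(2) by simp
  have lin: "(\<Sum>i\<in>UNIV. x $ i * ?r (P *v axis i 1) b) = ?r (P *v x) b" for x b
  proof -
    have "P *v x = P *v (\<Sum>i\<in>UNIV. x $ i *s axis i 1)"
      by (simp add: basis_expansion)
    also have "\<dots> = (\<Sum>i\<in>UNIV. x $ i *s (P *v axis i 1))"
      by (simp add: matrix_vector_mult_def axis_def vec_eq_iff if_distrib mult.commute cong: if_cong)
    finally show ?thesis
      using B PS by (simp add: vec.representation_sum vec.representation_scale vec.subspace_scale S)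
  qed
  have "trace (T ** P) = (\<Sum>i\<in>UNIV. (T *v (P *v axis i 1)) $ i)"
    by (simp add: trace_eq_herm herm_axis matrix_vector_mul_assoc)
  also have "\<dots> = (\<Sum>i\<in>UNIV. (T *v (\<Sum>b\<in>B. ?r (P *v axis i 1) b *s b)) $ i)"
    using r PS by simp
  also have "\<dots> = (\<Sum>i\<in>UNIV. \<Sum>b\<in>B. ?r (P *v axis i 1) b * (T *v b) $ i)"
    by (simp add: vec.linear_sum[OF matrix_vector_mul_linear_gen] vec.linear_scale[OF matrix_vector_mul_linear_gen])
  also have "\<dots> = (\<Sum>b\<in>B. \<Sum>i\<in>UNIV. ?r (P *v axis i 1) b * (T *v b) $ i)"
    by (rule sum.swap)
  also have "\<dots> = (\<Sum>b\<in>B. ?r (P *v (T *v b)) b)"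
    by (subst lin[symmetric]) (simp add: mult.commute)
  also have "\<dots> = (\<Sum>b\<in>B. ?r (T *v b) b)"
    using PS T B(2) by (auto intro!: sum.cong simp: vec.span_base)
  finally show ?thesis by (simp add: trace_on_def B_def Let_def)
qed

text \<open>The Rayleigh quotient attains its maximum on the compact unit sphere of
  \<open>W\<close>, and a maximizer is an eigenvector.\<close>

lemma hermitian_eigenvector_exists:
  fixes T :: "complex ^ 'n ^ 'n"
  assumes T: "adj T = T" and W: "vec.subspace W" and inv: "\<And>x. x \<in> W \<Longrightarrow> T *v x \<in> W"
    and nz: "W \<noteq> {0}"
  obtains v z where "v \<in> W" "v \<noteq> 0" "T *v v = z *s v"
proof -
  have RW: "subspace W" using W by (rule subspace_of_vec_subspace)
  define K where "K = W \<inter> sphere 0 1"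
  have sym: "inner (T *v x) y = inner x (T *v y)" for x y
    by (metis Re_herm T herm_adj)
  have "compact K"
    unfolding K_def using RW by (metis closed_Int_compact closed_subspace compact_sphere)
  moreover have "K \<noteq> {}"
  proof -
    obtain w where "w \<in> W" "w \<noteq> 0" using nz vec.subspace_0[OF W] by auto
    then have "(1 / norm w) *\<^sub>R w \<in> K" using RW by (auto simp: K_def subspace_scale)
    then show ?thesis by blast
  qed
  moreover have "continuous_on K (\<lambda>x. inner (T *v x) x)"
    by (intro continuous_intros)
  ultimately obtain v where v: "v \<in> K" "\<And>y. y \<in> K \<Longrightarrow> inner (T *v y) y \<le> inner (T *v v) v"
    using continuous_attains_sup[of K "\<lambda>x. inner (T *v x) x"] by blast
  define m where "m = inner (T *v v) v"
  have le: "inner (T *v y) y \<le> m * inner y y" if "y \<in> W" for y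
  proof (cases "y = 0")
    case False
    have "(1 / norm y) *\<^sub>R y \<in> K" using that RW False by (auto simp: K_def subspace_scale)
    from v(2)[OF this] have "inner (T *v y) y / (norm y)\<^sup>2 \<le> m"
      by (simp add: m_def linear_scale[OF matrix_vector_mul_linear] power2_eq_square)
    then show ?thesis using False by (simp add: field_simps dot_square_norm)
  qed simp
  define u where "u = T *v v - m *\<^sub>R v"
  have vW: "v \<in> W" and "norm v = 1" using v by (auto simp: K_def)
  have uW: "u \<in> W" using vW inv RW by (auto simp: u_def intro: subspace_diff subspace_scale)
  have vv: "inner v v = 1" using \<open>norm v = 1\<close> by (simp add: dot_square_norm)
  \<comment> \<open>The gradient \<open>u\<close> of the Rayleigh quotient at \<open>v\<close> must vanish, as moving from \<open>v\<close> along \<open>u\<close> cannot increase it.\<close>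
  have "2 * s * inner u u \<le> s\<^sup>2 * (m * inner u u - inner (T *v u) u)" for s
  proof -
    have "v + s *\<^sub>R u \<in> W" using vW uW RW by (auto intro: subspace_add subspace_scale)
    moreover have "inner (T *v u) v = inner (T *v v) u" by (metis sym inner_commute)
    then have "inner (T *v (v + s *\<^sub>R u)) (v + s *\<^sub>R u) =
        m + 2 * s * inner (T *v v) u + s\<^sup>2 * inner (T *v u) u"
      by (simp add: matrix_vector_right_distrib linear_scale[OF matrix_vector_mul_linear]
          inner_add_left inner_add_right m_def power2_eq_square algebra_simps)
    moreover have "inner (v + s *\<^sub>R u) (v + s *\<^sub>R u) = 1 + 2 * s * inner v u + s\<^sup>2 * inner u u"
      by (simp add: inner_add_left inner_add_right vv power2_eq_square algebra_simps inner_commute[of u v])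
    ultimately have
      "m + 2 * s * inner (T *v v) u + s\<^sup>2 * inner (T *v u) u \<le> m * (1 + 2 * s * inner v u + s\<^sup>2 * inner u u)"
      using le by metis
    moreover have "inner (T *v v) u = inner u u + m * inner v u"
    proof -
      have "inner u u = inner (T *v v - m *\<^sub>R v) u" by (simp add: u_def)
      then show ?thesis by (simp add: inner_diff_left)
    qed
    ultimately show ?thesis by (simp only:) (simp add: algebra_simps)
  qed
  note quad = this
  have "inner u u = 0"
  proof (rule ccontr)
    assume "inner u u \<noteq> 0"
    then have pos: "inner u u > 0" by (metis inner_gt_zero_iff inner_zero_left)
    \<comment> \<open>The summand 1 keeps \<open>C\<close> positive; with
      \<open>s = inner u u / C\<close> the quadratic term is at most half the linear one, a
      contradiction.\<close>
    define C where "C = \<bar>m * inner u u - inner (T *v u) u\<bar> + 1"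
    have C: "C > 0" "m * inner u u - inner (T *v u) u \<le> C" by (auto simp: C_def)
    define s where "s = inner u u / C"
    have "s > 0" using pos C by (simp add: s_def)
    have "2 * s * inner u u \<le> s\<^sup>2 * C"
      using quad[of s] C by (smt (verit) mult_left_mono zero_le_power2)
    also have "\<dots> = s * inner u u" using C by (simp add: s_def power2_eq_square)
    finally show False using \<open>s > 0\<close> pos by simp
  qed
  then have "T *v v = complex_of_real m *s v"
    by (simp add: u_def scaleR_vec_complex)
  then show ?thesis using that vW \<open>norm v = 1\<close> by (metis norm_zero zero_neq_one)
qed

text \<open>The orthogonal complement of the span is invariant under \<open>T\<close>, so if nonzero
  it would contain an eigenvector, which lies in the span as well.\<close>

lemma hermitian_span_eigenvectors:
  fixes T :: "complex ^ 'n ^ 'n"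
  assumes T: "adj T = T"
  shows "vec.span {v. \<exists>z. T *v v = z *s v} = UNIV"
proof (rule ccontr)
  let ?S = "vec.span {v. \<exists>z. T *v v = z *s v}"
  assume "?S \<noteq> UNIV"
  then obtain x where x: "x \<notin> ?S" by blast
  have inv: "T *v s \<in> ?S" if "s \<in> ?S" for s
    using that
  proof (induction rule: vec.span_induct_alt)
    case base
    then show ?case by (simp add: vec.span_zero)
  next
    case (step a v y)
    then obtain z where "T *v v = z *s v" by blast
    then have "T *v (a *s v + y) = (a * z) *s v + T *v y"
      by (simp add: matrix_vector_right_distrib vec.linear_scale[OF matrix_vector_mul_linear_gen])
    then show ?case using step by (simp add: vec.span_add vec.span_scale vec.span_base)
  qed
  obtain y where y: "y \<in> ?S" "x - y \<in> orth_compl ?S"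
    by (rule orth_decomposition[OF vec.subspace_span])
  have "orth_compl ?S \<noteq> {0}" using x y by force
  moreover have "T *v w \<in> orth_compl ?S" if "w \<in> orth_compl ?S" for w
    using that inv T by (auto simp: orth_compl_def herm_adj)
  ultimately obtain v z where v: "v \<in> orth_compl ?S" "v \<noteq> 0" "T *v v = z *s v"
    using hermitian_eigenvector_exists[OF T subspace_orth_compl, of ?S] by blast
  then have "v \<in> ?S" by (auto intro: vec.span_base)
  then show False using v orth_complD(1) herm_self_eq_0 by blast
qed

section \<open>The moment map\<close>

lemma Vn_simps:
  assumes "\<mu> \<in> Vn"
  shows "\<mu> (x + y) z = \<mu> x z + \<mu> y z" "\<mu> z (x + y) = \<mu> z x + \<mu> z y"
    "\<mu> (a *s x) z = a *s \<mu> x z" "\<mu> z (a *s x) = a *s \<mu> z x"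
    "\<mu> (x - y) z = \<mu> x z - \<mu> y z" "\<mu> z (x - y) = \<mu> z x - \<mu> z y"
    "\<mu> (- x) z = - \<mu> x z" "\<mu> z (- x) = - \<mu> z x"
    "\<mu> 0 z = 0" "\<mu> z 0 = 0" "\<mu> x x = 0"
proof -
  have l: "Vector_Spaces.linear (*s) (*s) (\<mu> x)" "Vector_Spaces.linear (*s) (*s) (\<lambda>x. \<mu> x y)" for x y
    using assms by (auto simp: Vn_def)
  note r = l(1)[of z] and s = l(2)[of z]
  show "\<mu> (x + y) z = \<mu> x z + \<mu> y z" by (rule vec.linear_add[OF s])
  show "\<mu> z (x + y) = \<mu> z x + \<mu> z y" by (rule vec.linear_add[OF r])
  show "\<mu> (a *s x) z = a *s \<mu> x z" by (rule vec.linear_scale[OF s])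
  show "\<mu> z (a *s x) = a *s \<mu> z x" by (rule vec.linear_scale[OF r])
  show "\<mu> (x - y) z = \<mu> x z - \<mu> y z" by (rule vec.linear_diff[OF s])
  show "\<mu> z (x - y) = \<mu> z x - \<mu> z y" by (rule vec.linear_diff[OF r])
  show "\<mu> (- x) z = - \<mu> x z" by (rule vec.linear_neg[OF s])
  show "\<mu> z (- x) = - \<mu> z x" by (rule vec.linear_neg[OF r])
  show "\<mu> 0 z = 0" by (rule vec.linear_0[OF s])
  show "\<mu> z 0 = 0" by (rule vec.linear_0[OF r])
  show "\<mu> x x = 0" using assms by (auto simp: Vn_def)
qed

lemma Vn_antisym:
  assumes "\<mu> \<in> Vn"
  shows "\<mu> y x = - \<mu> x y"
proof -
  have "\<mu> (x + y) (x + y) = 0" using assms by (rule Vn_simps)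
  then have "\<mu> x y + \<mu> y x = 0"
    unfolding Vn_simps(1,2)[OF assms] by (simp add: Vn_simps(11)[OF assms] add.commute)
  then show ?thesis by (simp add: eq_neg_iff_add_eq_0 add.commute)
qed

lemma VnI:
  assumes "\<And>x y z. \<mu> x (y + z) = \<mu> x y + \<mu> x z" "\<And>a x y. \<mu> x (a *s y) = a *s \<mu> x y"
    "\<And>x. \<mu> x x = 0" "\<And>x y. \<mu> y x = - \<mu> x y"
  shows "\<mu> \<in> Vn"
proof -
  have *: "Vector_Spaces.linear (*s) (*s) (\<mu> x)" for x
    by unfold_locales (rule assms)+
  have "Vector_Spaces.linear (*s) (*s) (\<lambda>x. \<mu> x y)" for y
  proof -
    have "(\<lambda>x. \<mu> x y) = (\<lambda>x. - \<mu> y x)" by (rule ext) (rule assms(4))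
    then show ?thesis by (simp only:) (unfold_locales, simp_all add: assms(1,2))
  qed
  with * assms(3) show ?thesis by (auto simp: Vn_def)
qed

lemma ad_apply:
  assumes "\<mu> \<in> Vn"
  shows "ad \<mu> x *v y = \<mu> x y"
  unfolding ad_def using assms by (intro matrix_works) (simp add: Vn_def)

lemma matrix_vector_mult_minus_left: "(- A) *v x = - (A *v x)" for A :: "complex ^ 'n ^ 'n"
  by (simp add: vec_eq_iff matrix_vector_mult_def sum_negf)

lemma scaleR_matrix_vector: "(r *\<^sub>R A) *v x = r *\<^sub>R (A *v x)" for A :: "complex ^ 'n ^ 'n"
  by (simp add: vec_eq_iff matrix_vector_mult_def scaleR_sum_right)

lemma ad_simps:
  assumes "\<mu> \<in> Vn"
  shows "ad \<mu> (x + y) = ad \<mu> x + ad \<mu> y" "ad \<mu> (x - y) = ad \<mu> x - ad \<mu> y"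
    "ad \<mu> (- x) = - ad \<mu> x" "ad \<mu> (r *\<^sub>R x) = r *\<^sub>R ad \<mu> x" "ad \<mu> 0 = 0"
  using assms
  by (simp_all add: matrix_eq ad_apply Vn_simps matrix_vector_mult_add_rdistrib
     matrix_vector_mult_diff_rdistrib scaleR_matrix_vector)
   (simp_all add: scaleR_vec_complex matrix_vector_mult_minus_left Vn_simps ad_apply)

lemma V_inner_herm:
  "V_inner \<mu> \<nu> = (\<Sum>i\<in>UNIV. \<Sum>j\<in>UNIV. herm (\<mu> (axis i 1) (axis j 1)) (\<nu> (axis i 1) (axis j 1)))"
  by (simp add: V_inner_def herm_Parseval)

lemma Vn_eqI:
  assumes \<mu>: "\<mu> \<in> Vn" and \<nu>: "\<nu> \<in> Vn"
    and eq: "\<And>i j. \<mu> (axis i 1) (axis j 1) = \<nu> (axis i 1) (axis j 1)"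
  shows "\<mu> = \<nu>"
proof (intro ext)
  fix x y
  have "ad \<mu> (axis i 1) = ad \<nu> (axis i 1)" for i
    using eq \<mu> \<nu> by (simp add: ad_def matrix_def vec_eq_iff)
  then have "\<mu> (axis i 1) y = \<nu> (axis i 1) y" for i y
    by (simp flip: ad_apply[OF \<mu>] ad_apply[OF \<nu>])
  \<comment> \<open>Antisymmetry carries the agreement on basis vectors over to the second argument,
    that is, to the columns of \<open>ad\<close>.\<close>
  then have "ad \<mu> y = ad \<nu> y" for y
    using Vn_antisym[OF \<mu>, of y] Vn_antisym[OF \<nu>, of y] by (simp add: ad_def matrix_def vec_eq_iff)
  then show "\<mu> x y = \<nu> x y"
    by (simp flip: ad_apply[OF \<mu>] ad_apply[OF \<nu>])
qed

lemma V_inner_self_eq_0: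
  assumes \<mu>: "\<mu> \<in> Vn" and "V_inner \<mu> \<mu> = 0"
  shows "\<mu> = (\<lambda>x y. 0)"
proof (rule Vn_eqI[OF \<mu>])
  show "(\<lambda>x y. 0) \<in> Vn" by (rule VnI) simp_all
  let ?f = "\<lambda>i j. inner (\<mu> (axis i 1) (axis j 1)) (\<mu> (axis i 1) (axis j 1))"
  have "(\<Sum>i\<in>UNIV. \<Sum>j\<in>UNIV. ?f i j) = Re (V_inner \<mu> \<mu>)"
    by (simp add: V_inner_herm Re_herm)
  then have "(\<Sum>i\<in>UNIV. \<Sum>j\<in>UNIV. ?f i j) = 0" using assms by simp
  then have "?f i j = 0" for i j
    by (simp add: sum_nonneg_eq_0_iff sum_nonneg)
  then show "\<mu> (axis i 1) (axis j 1) = 0" for i j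
    by (simp add: inner_eq_zero_iff)
qed

text \<open>The derivative at the identity of the change-of-basis action on brackets; its
  annihilator at \<mu> is \<open>Der \<mu>\<close>.\<close>

definition act :: "complex ^ 'n ^ 'n \<Rightarrow> 'n::finite bracket \<Rightarrow> 'n bracket" where
  "act E \<mu> = (\<lambda>x y. E *v \<mu> x y - \<mu> (E *v x) y - \<mu> x (E *v y))"

lemma Der_iff_act: "E \<in> Der \<mu> \<longleftrightarrow> act E \<mu> = (\<lambda>x y. 0)"
  by (auto simp: Der_def act_def fun_eq_iff algebra_simps)

lemma matrix_vector_scale: "A *v (a *s x) = a *s (A *v x)" for A :: "complex ^ 'n ^ 'n"
  by (rule vec.linear_scale[OF matrix_vector_mul_linear_gen])

lemma matrix_vector_neg: "A *v (- x) = - (A *v x)" for A :: "complex ^ 'n ^ 'n"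
  by (rule vec.linear_neg[OF matrix_vector_mul_linear_gen])

lemma act_in_Vn:
  assumes "\<mu> \<in> Vn"
  shows "act E \<mu> \<in> Vn"
proof (rule VnI)
  fix x y show "act E \<mu> y x = - act E \<mu> x y"
    using assms by (simp add: act_def Vn_antisym[OF assms, of y x] matrix_vector_neg
      Vn_antisym[OF assms, of y "E *v x"]  Vn_antisym[OF assms, of "E *v y" x])
next
  fix x show "act E \<mu> x x = 0"
    by (simp add: act_def Vn_simps[OF assms] Vn_antisym[OF assms, of "E *v x" x])
qed (simp_all add: act_def Vn_simps[OF assms] matrix_vector_right_distrib matrix_vector_scale
      vec.scale_right_diff_distrib algebra_simps)

text \<open>\<open>act\<close> is a representation of the Lie algebra of matrices.\<close>

lemma act_commutator:
  assumes "\<mu> \<in> Vn"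
  shows "act E (act F \<mu>) x y = act (commutator E F) \<mu> x y + act F (act E \<mu>) x y"
  by (simp add: act_def commutator_def Vn_simps[OF assms] matrix_vector_mult_diff_distrib
      matrix_vector_mult_diff_rdistrib algebra_simps flip: matrix_vector_mul_assoc)

text \<open>Both sides expand to the double sum of
  \<open>E $ k $ i * f (axis k 1) (axis i 1)\<close>. This moves a matrix between the input slots of
  two brackets.\<close>

lemma sum_sesquilinear_adj:
  fixes f :: "complex ^ 'n \<Rightarrow> complex ^ 'n \<Rightarrow> complex"
  assumes add: "\<And>x y z. f (x + y) z = f x z + f y z" "\<And>x y z. f z (x + y) = f z x + f z y"
    and scale: "\<And>a x y. f (a *s x) y = a * f x y" "\<And>a x y. f x (a *s y) = cnj a * f x y"
  shows "(\<Sum>i\<in>UNIV. f (E *v axis i 1) (axis i 1)) = (\<Sum>i\<in>UNIV. f (axis i 1) (adj E *v axis i 1))"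
proof -
  have f0: "f 0 y = 0" "f x 0 = 0" for x y
    using scale(1)[of 0 0 y] scale(2)[of x 0 0] by simp_all
  have fsum: "f (sum g I) y = (\<Sum>i\<in>I. f (g i) y)" "f y (sum g I) = (\<Sum>i\<in>I. f y (g i))"
    for g :: "'n \<Rightarrow> complex ^ 'n" and y I
    by (induction I rule: infinite_finite_induct; simp add: f0 add)+
  have col: "A *v axis i 1 = (\<Sum>k\<in>UNIV. A $ k $ i *s axis k 1)" for A :: "complex ^ 'n ^ 'n" and i
    by (simp add: vec_eq_iff matrix_vector_mult_def axis_def if_distrib cong: if_cong)
  have "(\<Sum>i\<in>UNIV. f (E *v axis i 1) (axis i 1)) =
      (\<Sum>i\<in>UNIV. \<Sum>k\<in>UNIV. E $ k $ i * f (axis k 1) (axis i 1))"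
    by (simp add: col fsum scale)
  also have "\<dots> = (\<Sum>k\<in>UNIV. \<Sum>i\<in>UNIV. E $ k $ i * f (axis k 1) (axis i 1))"
    by (rule sum.swap)
  also have "\<dots> = (\<Sum>i\<in>UNIV. f (axis i 1) (adj E *v axis i 1))"
    by (simp add: col fsum scale adj_def)
  finally show ?thesis .
qed

text \<open>Each of the three terms of \<open>act\<close> is moved separately: the output term by
  \<open>herm_adj\<close>, the two input terms by contraction over the basis.\<close>

lemma V_inner_act:
  assumes \<mu>: "\<mu> \<in> Vn" and \<nu>: "\<nu> \<in> Vn"
  shows "V_inner (act E \<mu>) \<nu> = V_inner \<mu> (act (adj E) \<nu>)"
proof -
  let ?e = "\<lambda>i. axis i 1 :: complex ^ 'a"
  have 1: "(\<Sum>i\<in>UNIV. herm (\<mu> (E *v ?e i) y) (\<nu> (?e i) y)) =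
      (\<Sum>i\<in>UNIV. herm (\<mu> (?e i) y) (\<nu> (adj E *v ?e i) y))" for y
    by (rule sum_sesquilinear_adj[where f = "\<lambda>u v. herm (\<mu> u y) (\<nu> v y)"])
      (simp_all add: Vn_simps[OF \<mu>] Vn_simps[OF \<nu>] herm_simps)
  have 2: "(\<Sum>i\<in>UNIV. herm (\<mu> y (E *v ?e i)) (\<nu> y (?e i))) =
      (\<Sum>i\<in>UNIV. herm (\<mu> y (?e i)) (\<nu> y (adj E *v ?e i)))" for y
    by (rule sum_sesquilinear_adj[where f = "\<lambda>u v. herm (\<mu> y u) (\<nu> y v)"])
      (simp_all add: Vn_simps[OF \<mu>] Vn_simps[OF \<nu>] herm_simps)
  have 3: "(\<Sum>i\<in>UNIV. \<Sum>j\<in>UNIV. herm (\<mu> (E *v ?e i) (?e j)) (\<nu> (?e i) (?e j))) =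
      (\<Sum>i\<in>UNIV. \<Sum>j\<in>UNIV. herm (\<mu> (?e i) (?e j)) (\<nu> (adj E *v ?e i) (?e j)))"
    by (subst (1 2) sum.swap) (simp add: 1)
  show ?thesis
    by (simp add: V_inner_herm act_def herm_simps sum_subtractf herm_adj 2 3)
qed

lemma trace_sum: "trace (\<Sum>i\<in>I. f i) = (\<Sum>i\<in>I. trace (f i :: complex ^ 'n ^ 'n))"
  by (induction I rule: infinite_finite_induct) (simp_all add: trace_add, simp_all add: trace_def)

lemma trace_scaleR: "trace (r *\<^sub>R A) = r *\<^sub>R trace A" for A :: "complex ^ 'n ^ 'n"
  by (simp add: trace_def scaleR_sum_right)

lemma matrix_mult_sum:
  "(\<Sum>i\<in>I. f i) ** B = (\<Sum>i\<in>I. (f i :: complex ^ 'n ^ 'n) ** B)" for B :: "complex ^ 'n ^ 'n"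
  by (induction I rule: infinite_finite_induct) (simp_all add: matrix_mult_simps)

lemma matrix_mult_scaleR:
  "(r *\<^sub>R A) ** B = r *\<^sub>R (A ** B)" for A B :: "complex ^ 'n ^ 'n"
  by (simp add: matrix_matrix_mult_def vec_eq_iff scaleR_sum_right)

text \<open>In other words, \<open>M_op\<close> is up to scaling the moment map of the action on \<open>Vn\<close>.\<close>

lemma trace_M_op:
  assumes \<mu>: "\<mu> \<in> Vn"
  shows "trace (M_op \<mu> ** F) = 2 * V_inner (act F \<mu>) \<mu>"
proof -
  let ?e = "\<lambda>i. axis i 1 :: complex ^ 'a"
  let ?A = "\<lambda>i. ad \<mu> (?e i)"
  have 1: "(\<Sum>j\<in>UNIV. herm (F *v \<mu> (?e i) (?e j)) (\<mu> (?e i) (?e j))) = trace (?A i ** adj (?A i) ** F)" for i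
  proof -
    have "(\<Sum>j\<in>UNIV. herm (F *v \<mu> (?e i) (?e j)) (\<mu> (?e i) (?e j))) = trace (adj (?A i) ** (F ** ?A i))"
      by (simp add: trace_eq_herm herm_adj ad_apply[OF \<mu>] flip: matrix_vector_mul_assoc)
    also have "\<dots> = trace (F ** ?A i ** adj (?A i))" by (rule trace_mul_sym)
    also have "\<dots> = trace (F ** (?A i ** adj (?A i)))" by (simp only: matrix_mul_assoc)
    also have "\<dots> = trace (?A i ** adj (?A i) ** F)" by (rule trace_mul_sym)
    finally show ?thesis .
  qed
  have 2: "(\<Sum>j\<in>UNIV. herm (\<mu> (?e i) (F *v ?e j)) (\<mu> (?e i) (?e j))) = trace (adj (?A i) ** ?A i ** F)" for i
    by (simp add: trace_eq_herm herm_adj ad_apply[OF \<mu>] flip: matrix_vector_mul_assoc)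
  \<comment> \<open>By antisymmetry both input terms of \<open>act\<close> contribute equally, which
    accounts for the coefficient -4 against 2 in \<open>M_op\<close>.\<close>
  have 3: "(\<Sum>i\<in>UNIV. \<Sum>j\<in>UNIV. herm (\<mu> (F *v ?e i) (?e j)) (\<mu> (?e i) (?e j))) =
    (\<Sum>j\<in>UNIV. \<Sum>i\<in>UNIV. herm (\<mu> (?e j) (F *v ?e i)) (\<mu> (?e j) (?e i)))"
    by (subst sum.swap, intro sum.cong refl,
       subst (1 2) Vn_antisym[OF \<mu>]) (simp add: herm_simps)
  show ?thesis
    by (simp add: M_op_def V_inner_herm act_def herm_simps sum_subtractf 3 1 2 trace_add trace_scaleR
       trace_sum matrix_mult_sum matrix_mult_scaleR matrix_mult_simps(1,3) trace_sub sum.distrib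
       scaleR_conv_of_real[where 'a = complex] algebra_simps)
qed

lemma adj_M_op: "adj (M_op \<mu>) = M_op \<mu>"
  by (simp add: M_op_def adj_simps adj_sum adj_mult)

text \<open>The identity matrix acts as -1 on brackets, so the trace of \<open>M_op \<mu>\<close> is
  -2 times the squared norm of \<mu>.\<close>

lemma M_op_eq_0:
  assumes \<mu>: "\<mu> \<in> Vn" and "M_op \<mu> = 0"
  shows "\<mu> = (\<lambda>x y. 0)"
proof (rule V_inner_self_eq_0[OF \<mu>])
  have "act (mat 1) \<mu> = (\<lambda>x y. - \<mu> x y)" by (simp add: act_def)
  then show "V_inner \<mu> \<mu> = 0"
    using trace_M_op[OF \<mu>, of "mat 1"] assms(2)
    by (simp add: V_inner_herm herm_simps sum_negf) (simp add: trace_def)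
qed

section \<open>Derivations of a critical bracket and their adjoints\<close>

locale critical_bracket =
  fixes \<mu> :: "'n::finite bracket" and c :: real and D :: "complex ^ 'n ^ 'n"
  assumes \<mu>: "\<mu> \<in> Vn" and jac: "jacobi \<mu>" and nz: "\<mu> \<noteq> (\<lambda>x y. 0)"
    and M_eq: "M_op \<mu> = mat (complex_of_real c) + D"
    and D_der: "D \<in> Der \<mu>"
begin

lemmas br = Vn_simps[OF \<mu>]
lemmas br_anti = Vn_antisym[OF \<mu>]
lemmas ad_app = ad_apply[OF \<mu>]

lemma adj_D: "adj D = D"
  using adj_M_op[of \<mu>] unfolding M_eq by (simp add: adj_simps adj_mat_of_real)

text \<open>If \<open>c = 0\<close>, then \<open>M_op \<mu>\<close> is itself a derivation; pairing
  it with itself through the moment map gives 0, which forces \<open>M_op \<mu> = 0\<close>.\<close>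

lemma c_nonzero: "c \<noteq> 0"
proof
  assume "c = 0"
  then have "M_op \<mu> = D" using M_eq by (simp add: mat_def vec_eq_iff)
  then have "trace (M_op \<mu> ** M_op \<mu>) = 0"
    using trace_M_op[OF \<mu>, of D] D_der by (simp add: Der_iff_act V_inner_herm herm_simps)
  then have "inner (M_op \<mu>) (M_op \<mu>) = 0" by (simp add: inner_matrix adj_M_op)
  then show False using M_op_eq_0[OF \<mu>] nz by simp
qed

text \<open>The pairing of \<open>M_op \<mu>\<close> with \<open>commutator E (adj E)\<close>
  vanishes: the scalar part because scalars are central, the part \<open>D\<close> because it
  commutes with \<open>E\<close>.\<close>

lemma Der_adj:
  assumes E: "E \<in> Der \<mu>" and comm: "D ** E = E ** D"
  shows "adj E \<in> Der \<mu>"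
proof -
  let ?\<nu> = "act (adj E) \<mu>"
  have "trace (mat (complex_of_real c) ** commutator E (adj E)) =
     trace (commutator (mat (complex_of_real c)) E ** adj E)"
    by (simp add: trace_commutator)
  also have "commutator (mat (complex_of_real c)) E = 0"
    by (simp add: commutator_def matrix_matrix_mult_def mat_def vec_eq_iff if_distrib if_distribR mult.commute
         cong: if_cong)
  finally have "trace (mat (complex_of_real c) ** commutator E (adj E)) = 0"
    by (simp add: matrix_mult_simps) (simp add: trace_def)
  moreover have "trace (D ** commutator E (adj E)) = 0"
  proof -
    have "trace (D ** commutator E (adj E)) = trace (commutator D E ** adj E)"
      by (simp add: trace_commutator)
    also have "commutator D E = 0" using comm by (simp add: commutator_def)
    finally show ?thesis by (simp add: matrix_mult_simps) (simp add: trace_def)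
  qed
  ultimately have "trace (M_op \<mu> ** commutator E (adj E)) = 0"
    by (simp add: M_eq matrix_mult_simps trace_add)
  then have "V_inner (act (commutator E (adj E)) \<mu>) \<mu> = 0"
    by (simp add: trace_M_op[OF \<mu>])
  \<comment> \<open>Since \<open>E\<close> annihilates \<mu>, only the commutator term survives;
    pairing with \<mu> then yields the squared norm of \<open>?\<nu>\<close>.\<close>
  moreover have "act E ?\<nu> = act (commutator E (adj E)) \<mu>"
  proof -
    have "act (adj E) (act E \<mu>) = (\<lambda>x y. 0)"
      using E by (simp add: Der_iff_act) (simp add: act_def)
    then show ?thesis using act_commutator[OF \<mu>, of E "adj E"] by (simp add: fun_eq_iff)
  qed
  ultimately have "V_inner ?\<nu> ?\<nu> = 0"
    using V_inner_act[OF act_in_Vn[OF \<mu>] \<mu>, of E "adj E"] by simp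
  then show ?thesis
    using V_inner_self_eq_0[OF act_in_Vn[OF \<mu>], of "adj E"] by (simp add: Der_iff_act)
qed

lemma Der_commutator:
  assumes "E \<in> Der \<mu>"
  shows "commutator E (ad \<mu> x) = ad \<mu> (E *v x)"
  using assms
  by (simp add: matrix_eq commutator_def ad_app Der_def matrix_vector_mult_diff_rdistrib
       flip: matrix_vector_mul_assoc)

lemma ad_Der: "ad \<mu> x \<in> Der \<mu>"
proof -
  have "\<mu> x (\<mu> y z) = \<mu> (\<mu> x y) z + \<mu> y (\<mu> x z)" for y z
  proof -
    have "\<mu> x (\<mu> y z) + \<mu> y (\<mu> z x) + \<mu> z (\<mu> x y) = 0"
      using jac by (simp add: jacobi_def)
    then show ?thesis
      using br_anti[of z x] br_anti[of z "\<mu> x y"] by (simp add: br eq_neg_iff_add_eq_0 algebra_simps)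
  qed
  then show ?thesis by (simp add: Der_def ad_app)
qed

lemma ad_bracket: "ad \<mu> (\<mu> x y) = commutator (ad \<mu> x) (ad \<mu> y)"
  by (simp add: Der_commutator[OF ad_Der] ad_app)

lemma commute_D: "D *v A = 0 \<Longrightarrow> D ** ad \<mu> A = ad \<mu> A ** D"
  using Der_commutator[OF D_der, of A] ad_simps(5)[OF \<mu>] by (simp add: commutator_def)

lemma commute_D_adj: "D *v A = 0 \<Longrightarrow> D ** adj (ad \<mu> A) = adj (ad \<mu> A) ** D"
  using arg_cong[OF commute_D, of A adj] by (simp add: adj_mult adj_D)

lemma adj_ad_Der: "D *v A = 0 \<Longrightarrow> adj (ad \<mu> A) \<in> Der \<mu>"
  by (intro Der_adj ad_Der commute_D)

end

section \<open>The structure of the kernel of the derivation\<close>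

text \<open>Replaces a matrix equation by a condition that the simplifier can check for sums,
  multiples and brackets of candidates.\<close>

lemma adj_ad_iff:
  assumes "\<mu> \<in> Vn"
  shows "adj (ad \<mu> x) = ad \<mu> y \<longleftrightarrow> (\<forall>u v. herm (\<mu> x u) v = herm u (\<mu> y v))"
proof
  assume "adj (ad \<mu> x) = ad \<mu> y"
  then show "\<forall>u v. herm (\<mu> x u) v = herm u (\<mu> y v)"
    using assms by (metis ad_apply herm_adj)
next
  assume *: "\<forall>u v. herm (\<mu> x u) v = herm u (\<mu> y v)"
  have "adj (ad \<mu> x) *v v = ad \<mu> y *v v" for v
  proof (rule vec_eqI_herm)
    fix u
    have "herm u (adj (ad \<mu> x) *v v) = herm u (ad \<mu> y *v v)"
      using * assms by (simp add: ad_apply flip: herm_adj)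
    then show "herm (adj (ad \<mu> x) *v v) u = herm (ad \<mu> y *v v) u"
      by (metis herm_cnj)
  qed
  then show "adj (ad \<mu> x) = ad \<mu> y" by (simp add: matrix_eq)
qed

text \<open>Everything is phrased through the kernel of \<open>D\<close> and its orthogonal
  complement, free of eigenvalue lists; \<open>n_ideal\<close> is supplied later by the positivity
  of the other eigenvalues.\<close>

locale critical_reductive = critical_bracket +
  fixes h :: "(complex ^ 'n) set"
  assumes h_subalgebra: "subalgebra \<mu> h"
    and g_sum: "{x. D *v x = 0} = {x + y | x y. x \<in> h \<and> y \<in> center \<mu> {x. D *v x = 0}}"
    and g_direct: "h \<inter> center \<mu> {x. D *v x = 0} = {0}"
    and n_ideal: "\<And>x y. x \<in> orth_compl {x. D *v x = 0} \<Longrightarrow> \<mu> x y \<in> orth_compl {x. D *v x = 0}"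
begin

definition "g = {x. D *v x = 0}"
definition "a = center \<mu> g"
definition "n = orth_compl g"

lemma vec_subspaces: "vec.subspace h" "vec.subspace g" "vec.subspace a" "vec.subspace n"
proof -
  show "vec.subspace h" using h_subalgebra by (simp add: subalgebra_def)
  show "vec.subspace g"
    by (auto simp: g_def vec.subspace_def matrix_vector_right_distrib matrix_vector_scale)
  then show "vec.subspace a"
    by (auto simp: a_def center_def vec.subspace_def br)
  show "vec.subspace n" unfolding n_def by (rule subspace_orth_compl)
qed

lemmas h_closed = vec.subspace_add[OF vec_subspaces(1)] vec.subspace_diff[OF vec_subspaces(1)]
  vec.subspace_scale[OF vec_subspaces(1)] vec.subspace_neg[OF vec_subspaces(1)] vec.subspace_0[OF vec_subspaces(1)]

lemma h_bracket: "x \<in> h \<Longrightarrow> y \<in> h \<Longrightarrow> \<mu> x y \<in> h"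
  using h_subalgebra by (simp add: subalgebra_def)

lemma g_eq: "g = {x + y | x y. x \<in> h \<and> y \<in> a}"
  using g_sum unfolding g_def a_def .

lemma h_a: "h \<inter> a = {0}"
  using g_direct unfolding g_def a_def .

lemma h_g: "x \<in> h \<Longrightarrow> x \<in> g"
  using vec.subspace_0[OF vec_subspaces(3)] by (subst g_eq) force

lemma a_g: "x \<in> a \<Longrightarrow> x \<in> g"
  by (simp add: a_def center_def)

lemma a_central: "x \<in> a \<Longrightarrow> y \<in> g \<Longrightarrow> \<mu> x y = 0" "x \<in> a \<Longrightarrow> y \<in> g \<Longrightarrow> \<mu> y x = 0"
proof -
  show "\<mu> x y = 0" if "x \<in> a" "y \<in> g" using that by (simp add: a_def center_def)
  then show "\<mu> y x = 0" if "x \<in> a" "y \<in> g" using that br_anti[of y x] by simp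
qed

lemma n_bracket: "x \<in> n \<Longrightarrow> \<mu> x y \<in> n" "y \<in> n \<Longrightarrow> \<mu> x y \<in> n"
proof -
  show 1: "\<mu> x y \<in> n" if "x \<in> n" for x y
    using that unfolding n_def g_def by (rule n_ideal)
  show "\<mu> x y \<in> n" if "y \<in> n"
    unfolding br_anti[of x y] using vec_subspaces(4) 1[OF that] by (rule vec.subspace_neg)
qed

lemma orth_n: "x \<in> n \<Longrightarrow> y \<in> g \<Longrightarrow> herm x y = 0" "x \<in> n \<Longrightarrow> y \<in> g \<Longrightarrow> herm y x = 0"
  unfolding n_def by (auto intro: orth_complD)

lemma g_n_decomp: obtains u w where "u \<in> g" "w \<in> n" "x = u + w"
proof -
  obtain u where "u \<in> g" "x - u \<in> n"
    unfolding n_def by (rule orth_decomposition[OF vec_subspaces(2)])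
  then show ?thesis using that[of u "x - u"] by simp
qed

lemma adj_ad: "herm (adj (ad \<mu> x) *v y) z = herm y (\<mu> x z)"
  "herm y (adj (ad \<mu> x) *v z) = herm (\<mu> x y) z"
  by (simp_all add: ad_app flip: herm_adj herm_adj_right)

lemma adj_ad_derivation:
  assumes "x \<in> g"
  shows "adj (ad \<mu> x) *v \<mu> y z = \<mu> (adj (ad \<mu> x) *v y) z + \<mu> y (adj (ad \<mu> x) *v z)"
  using adj_ad_Der[of x] assms by (simp add: g_def Der_def)

lemma g_bracket: "x \<in> g \<Longrightarrow> y \<in> g \<Longrightarrow> \<mu> x y \<in> g"
  using D_der by (simp add: g_def Der_def br)

lemma adj_ad_g: "x \<in> g \<Longrightarrow> y \<in> g \<Longrightarrow> adj (ad \<mu> x) *v y \<in> g"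
  using commute_D_adj[of x] by (simp add: g_def matrix_vector_mul_assoc) (simp flip: matrix_vector_mul_assoc)

text \<open>As a derivation preserving \<open>g\<close>, the adjoint maps the center into itself,
  where \<open>\<mu> x\<close> vanishes; so the image has norm 0.\<close>

lemma adj_ad_a:
  assumes x: "x \<in> g" and y: "y \<in> a"
  shows "adj (ad \<mu> x) *v y = 0"
proof -
  have "\<mu> (adj (ad \<mu> x) *v y) z = 0" if z: "z \<in> g" for z
    using adj_ad_derivation[OF x, of y z] a_central[OF y z] a_central[OF y adj_ad_g[OF x z]] by simp
  moreover have "adj (ad \<mu> x) *v y \<in> g" using x a_g[OF y] by (rule adj_ad_g)
  ultimately have "adj (ad \<mu> x) *v y \<in> a" by (simp add: a_def center_def)
  then have "\<mu> x (adj (ad \<mu> x) *v y) = 0" using a_central x by blast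
  then have "herm (adj (ad \<mu> x) *v y) (adj (ad \<mu> x) *v y) = 0"
    by (simp add: adj_ad herm_simps)
  then show ?thesis by simp
qed

text \<open>Brackets inside \<open>g\<close> are handled by \<open>adj_ad_a\<close>; all others lie
  in \<open>n\<close>, which is orthogonal to \<open>g\<close>.\<close>

lemma a_orth_bracket:
  assumes x: "x \<in> a"
  shows "herm x (\<mu> y z) = 0"
proof -
  obtain u w where y: "u \<in> g" "w \<in> n" "y = u + w" by (rule g_n_decomp)
  obtain u' w' where z: "u' \<in> g" "w' \<in> n" "z = u' + w'" by (rule g_n_decomp)
  have "herm x (\<mu> u u') = 0"
    using adj_ad_a[OF y(1) x] adj_ad(1)[of u x u'] by (simp add: herm_simps)
  moreover have "herm x (\<mu> u w') = 0" "herm x (\<mu> w z) = 0"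
    by (simp_all add: orth_n(2) n_bracket y(2) z(2) a_g[OF x])
  ultimately show ?thesis using y(3) z(3) by (simp add: br herm_simps)
qed

text \<open>The converse inside \<open>g\<close>. First every \<open>adj (ad \<mu> x)\<close> with
  \<open>x\<close> in \<open>g\<close> kills \<open>z\<close>, hence commutes with
  \<open>ad \<mu> z\<close>. Taking adjoints, \<open>adj (ad \<mu> z)\<close> maps \<open>g\<close>
  into the center, then to 0 by a norm computation, so \<open>ad \<mu> z\<close> vanishes on
  \<open>g\<close> too.\<close>

lemma orth_brackets_central:
  assumes z: "z \<in> g" and orth: "\<And>x y. x \<in> g \<Longrightarrow> y \<in> g \<Longrightarrow> herm z (\<mu> x y) = 0"
  shows "z \<in> a"
proof -
  have adj_0: "adj (ad \<mu> x) *v z = 0" if "x \<in> g" for x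
  proof -
    have "herm (adj (ad \<mu> x) *v z) (adj (ad \<mu> x) *v z) = 0"
      using orth[OF that adj_ad_g[OF that z]] by (simp add: adj_ad(1))
    then show ?thesis by simp
  qed
  have in_a: "adj (ad \<mu> z) *v x \<in> a" if x: "x \<in> g" for x
  proof -
    have "commutator (adj (ad \<mu> x)) (ad \<mu> z) = 0"
      using Der_commutator adj_ad_Der x adj_0[OF x] ad_simps(5)[OF \<mu>] by (simp add: g_def)
    then have "adj (commutator (adj (ad \<mu> x)) (ad \<mu> z)) = 0" by (simp add: adj_simps)
    then have "commutator (adj (ad \<mu> z)) (ad \<mu> x) = 0" by (simp add: adj_commutator)
    then have "ad \<mu> (adj (ad \<mu> z) *v x) = 0"
      using Der_commutator adj_ad_Der z by (simp add: g_def)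
    then have "\<mu> (adj (ad \<mu> z) *v x) y = 0" for y
      by (metis ad_app matrix_vector_mult_0)
    then show ?thesis using adj_ad_g[OF z x] by (simp add: a_def center_def)
  qed
  have "\<mu> z x = 0" if x: "x \<in> g" for x
  proof -
    have adj_z: "adj (ad \<mu> z) *v y = 0" if y: "y \<in> g" for y
    proof -
      have "\<mu> z (adj (ad \<mu> z) *v y) = 0" using a_central in_a[OF y] z by blast
      then have "herm (adj (ad \<mu> z) *v y) (adj (ad \<mu> z) *v y) = 0"
        by (simp add: adj_ad herm_simps)
      then show ?thesis by simp
    qed
    have "herm (\<mu> z x) (\<mu> z x) = 0"
      using adj_z[OF g_bracket[OF z x]] adj_ad(2)[of x z "\<mu> z x"] by (simp add: herm_simps)
    then show ?thesis by simp
  qed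
  then show ?thesis using z by (simp add: a_def center_def)
qed

text \<open>Since \<open>a\<close> is central, brackets of \<open>g\<close> are brackets of
  \<open>h\<close>. The part of an element of \<open>h\<close> orthogonal to them is central, so it
  lies in \<open>h \<inter> a\<close>.\<close>

lemma h_perfect: "h = vec.span {\<mu> x y | x y. x \<in> h \<and> y \<in> h}" (is "h = ?S")
proof
  show S_h: "?S \<subseteq> h"
    using h_bracket vec_subspaces(1) by (intro vec.span_minimal) auto
  show "h \<subseteq> ?S"
  proof
    fix x assume x: "x \<in> h"
    obtain y where y: "y \<in> ?S" "x - y \<in> orth_compl ?S"
      by (rule orth_decomposition[OF vec.subspace_span])
    have xy: "x - y \<in> h" using x y S_h h_closed by blast
    have "x - y \<in> a"
    proof (rule orth_brackets_central)
      show "x - y \<in> g" using xy by (rule h_g)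
      fix u v assume "u \<in> g" "v \<in> g"
      then obtain u1 u2 v1 v2 where uv: "u1 \<in> h" "u2 \<in> a" "u = u1 + u2" "v1 \<in> h" "v2 \<in> a" "v = v1 + v2"
        unfolding g_eq by blast
      then have "\<mu> u v = \<mu> u1 v1"
        using a_central h_g a_g \<open>v \<in> g\<close> by (simp add: br)
      then have "\<mu> u v \<in> ?S" using uv by (auto intro: vec.span_base)
      then show "herm (x - y) (\<mu> u v) = 0" using y(2) orth_complD by blast
    qed
    then have "x - y \<in> h \<inter> a" using xy by blast
    then show "x \<in> ?S" unfolding h_a using y(1) by simp
  qed
qed

text \<open>By \<open>h_perfect\<close>, membership in a complex subspace need only be checked on
  brackets.\<close>

lemma h_induct [consumes 1, case_names bracket subspace]:
  assumes "x \<in> h" and "\<And>x y. x \<in> h \<Longrightarrow> y \<in> h \<Longrightarrow> \<mu> x y \<in> S" and "vec.subspace S"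
  shows "x \<in> S"
proof -
  have "h \<subseteq> S" by (subst h_perfect) (use assms(2,3) in \<open>intro vec.span_minimal, auto\<close>)
  then show ?thesis using assms(1) by blast
qed

lemma a_orth_h:
  assumes "y \<in> a" "x \<in> h"
  shows "herm y x = 0" "herm x y = 0"
proof -
  have "x \<in> orth_compl {y}"
    using assms(2)
  proof (induction rule: h_induct)
    case (bracket u v)
    have "cnj (herm y (\<mu> u v)) = 0" using a_orth_bracket[OF assms(1)] by simp
    then show ?case by (simp add: orth_compl_def herm_cnj)
  qed (rule subspace_orth_compl)
  then show "herm y x = 0" "herm x y = 0" using orth_complD by blast+
qed

text \<open>The \<open>a\<close>-component of the image is orthogonal to the whole image, because
  \<open>\<mu> x\<close> kills \<open>a\<close>, and to \<open>h\<close>; hence it is zero.\<close>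

lemma adj_ad_h:
  assumes x: "x \<in> g" and y: "y \<in> h"
  shows "adj (ad \<mu> x) *v y \<in> h"
proof -
  obtain u v where uv: "u \<in> h" "v \<in> a" "adj (ad \<mu> x) *v y = u + v"
    using adj_ad_g[OF x h_g[OF y]] unfolding g_eq by blast
  have "herm (u + v) v = 0"
    using uv a_central[OF uv(2) x] adj_ad(1)[of x y v] by (simp add: herm_simps)
  then have "v = 0" using a_orth_h uv by (simp add: herm_simps)
  then show ?thesis using uv by simp
qed

lemma ad_h:
  assumes x: "x \<in> g" and y: "y \<in> h"
  shows "\<mu> x y \<in> h"
proof -
  obtain u v where "u \<in> h" "v \<in> a" "x = u + v" using x unfolding g_eq by blast
  then show ?thesis using y h_bracket a_central(1) h_g by (simp add: br)
qed

text \<open>An element of \<open>h\<close> with zero \<open>ad\<close> is central. This allows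
  identities in \<open>h\<close> to be tested on operators.\<close>

lemma ad_inj_on_h:
  assumes "x \<in> h" "y \<in> h" "ad \<mu> x = ad \<mu> y"
  shows "x = y"
proof -
  have "\<mu> (x - y) z = 0" for z using assms(3) by (simp add: br) (metis ad_app)
  then have "x - y \<in> a" using assms h_closed h_g by (simp add: a_def center_def)
  then have "x - y \<in> h \<inter> a" using assms h_closed by blast
  then show ?thesis unfolding h_a by simp
qed

lemma ad_a_normal:
  assumes "x \<in> a"
  shows "ad \<mu> x ** adj (ad \<mu> x) = adj (ad \<mu> x) ** ad \<mu> x"
proof -
  have "commutator (adj (ad \<mu> x)) (ad \<mu> x) = ad \<mu> (adj (ad \<mu> x) *v x)"
    using assms a_g by (intro Der_commutator adj_ad_Der) (simp add: g_def)
  also have "\<dots> = 0" using assms a_g by (simp add: adj_ad_a ad_simps(5)[OF \<mu>])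
  finally show ?thesis by (simp add: commutator_def)
qed

text \<open>Meaningful on \<open>h\<close> only, where existence is proved next and uniqueness is
  \<open>ad_inj_on_h\<close>. Its negative is the Cartan involution with fixed points
  \<open>k\<close>.\<close>

definition star :: "complex ^ 'n \<Rightarrow> complex ^ 'n" where
  "star x = (SOME y. y \<in> h \<and> ad \<mu> y = adj (ad \<mu> x))"

lemma star:
  assumes "x \<in> h"
  shows "star x \<in> h" "ad \<mu> (star x) = adj (ad \<mu> x)"
proof -
  let ?S = "{x. \<exists>y\<in>h. \<forall>u v. herm (\<mu> x u) v = herm u (\<mu> y v)}"
  have "x \<in> ?S"
    using assms
  proof (induction rule: h_induct)
    case (bracket x y)
    have "adj (commutator (ad \<mu> x) (ad \<mu> y)) \<in> ad \<mu> ` h"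
    proof (rule subspace_adj_commutator)
      show "subspace (ad \<mu> ` h)"
        by (rule linear_subspace_image)
          (use subspace_of_vec_subspace[OF vec_subspaces(1)] in \<open>auto intro!: linearI simp: ad_simps[OF \<mu>]\<close>)
      fix X Y assume "X \<in> ad \<mu> ` h" "Y \<in> ad \<mu> ` h"
      then obtain u v where uv: "u \<in> h" "v \<in> h" "X = ad \<mu> u" "Y = ad \<mu> v" by blast
      have "commutator X (adj Y) = - commutator (adj (ad \<mu> v)) (ad \<mu> u)"
        unfolding uv(3,4) by (rule commutator_simps(3))
      also have "\<dots> = ad \<mu> (- (adj (ad \<mu> v) *v u))"
        using Der_commutator[OF adj_ad_Der, of v u] h_g[OF uv(2)] by (simp add: g_def ad_simps[OF \<mu>])
      finally show "commutator X (adj Y) \<in> ad \<mu> ` h"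
        using adj_ad_h uv h_g h_closed by auto
    qed (use bracket in auto)
    then show ?case using adj_ad_iff[OF \<mu>, of "\<mu> x y"] by (auto simp: ad_bracket)
  next
    case subspace
    show ?case
      unfolding vec.subspace_def
    proof safe
      show "\<exists>y\<in>h. \<forall>u v. herm (\<mu> 0 u) v = herm u (\<mu> y v)"
        by (rule bexI[of _ 0]) (auto simp: br herm_simps h_closed)
      fix x1 y1 x2 y2
      assume *: "y1 \<in> h" "\<forall>u v. herm (\<mu> x1 u) v = herm u (\<mu> y1 v)"
      show "\<exists>y\<in>h. \<forall>u v. herm (\<mu> (k *s x1) u) v = herm u (\<mu> y v)" for k
        \<comment> \<open>The conjugate appears because the adjoint is conjugate linear.\<close>
        by (rule bexI[of _ "cnj k *s y1"]) (use * in \<open>auto simp: br herm_simps h_closed\<close>)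
      assume **: "y2 \<in> h" "\<forall>u v. herm (\<mu> x2 u) v = herm u (\<mu> y2 v)"
      show "\<exists>y\<in>h. \<forall>u v. herm (\<mu> (x1 + x2) u) v = herm u (\<mu> y v)"
        by (rule bexI[of _ "y1 + y2"]) (use * ** in \<open>auto simp: br herm_simps h_closed\<close>)
    qed
  qed
  then have "\<exists>y. y \<in> h \<and> ad \<mu> y = adj (ad \<mu> x)"
    unfolding mem_Collect_eq adj_ad_iff[OF \<mu>, symmetric] by (metis (no_types))
  then have "star x \<in> h \<and> ad \<mu> (star x) = adj (ad \<mu> x)"
    unfolding star_def by (rule someI_ex)
  then show "star x \<in> h" "ad \<mu> (star x) = adj (ad \<mu> x)" by auto
qed

lemma herm_star:
  assumes "x \<in> h"
  shows "herm (\<mu> x u) v = herm u (\<mu> (star x) v)" "herm u (\<mu> x v) = herm (\<mu> (star x) u) v"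
  using adj_ad(2)[of u x v] adj_ad(1)[of x u v]
  unfolding star(2)[OF assms, symmetric] ad_app by simp_all

lemma star_unique:
  assumes "x \<in> h" "y \<in> h" "\<And>u v. herm (\<mu> x u) v = herm u (\<mu> y v)"
  shows "star x = y"
proof -
  have "adj (ad \<mu> x) = ad \<mu> y" using assms(3) adj_ad_iff[OF \<mu>] by blast
  then show ?thesis using star[OF assms(1)] assms(2) ad_inj_on_h by metis
qed

lemma star_star: "x \<in> h \<Longrightarrow> star (star x) = x"
  by (rule star_unique) (simp_all add: star herm_star)

lemma star_add: "x \<in> h \<Longrightarrow> y \<in> h \<Longrightarrow> star (x + y) = star x + star y"
  by (rule star_unique) (simp_all add: star herm_star h_closed br herm_simps)

lemma star_scale: "x \<in> h \<Longrightarrow> star (k *s x) = cnj k *s star x"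
  by (rule star_unique) (simp_all add: star herm_star h_closed br herm_simps)

lemma star_neg: "x \<in> h \<Longrightarrow> star (- x) = - star x"
  by (rule star_unique) (simp_all add: star herm_star h_closed br herm_simps)

lemma star_0: "star 0 = 0"
  by (rule star_unique) (simp_all add: h_closed br herm_simps)

lemma bracket_bracket: "\<mu> (\<mu> x y) z = \<mu> x (\<mu> y z) - \<mu> y (\<mu> x z)"
  using ad_Der[of x] by (simp add: Der_def ad_app)

lemma star_bracket:
  assumes "x \<in> h" "y \<in> h"
  shows "star (\<mu> x y) = - \<mu> (star x) (star y)"
  by (rule star_unique)
    (use assms in \<open>simp_all add: star h_closed h_bracket br bracket_bracket herm_simps herm_star(1)\<close>)

text \<open>An invariant bilinear form on a perfect Lie algebra is symmetric: its antisymmetric part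
  evaluated at \<open>\<mu> z x\<close> and \<open>y\<close> is antisymmetric in \<open>z, x\<close> and symmetric in \<open>x, y\<close>.\<close>

lemma herm_star_symmetric:
  assumes "x \<in> h" and y: "y \<in> h"
  shows "herm x (star y) = herm y (star x)"
proof -
  define w where "w x y = herm x (star y) - herm y (star x)" for x y
  have sym: "w (\<mu> z x) y = w (\<mu> z y) x" if "x \<in> h" "y \<in> h" "z \<in> h" for x y z
    using that by (simp add: w_def star_bracket herm_simps herm_star(1) star)
  have anti: "w (\<mu> z x) y = - w (\<mu> x z) y" if "x \<in> h" "z \<in> h" for x y z
    using that by (simp add: w_def br_anti[of z x] herm_simps star_neg h_bracket)
  have "x \<in> {x \<in> h. w x y = 0}"
    using assms(1)
  proof (induction rule: h_induct)
    case (bracket z x)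
    have "w (\<mu> z x) y = - w (\<mu> z x) y"
      using sym anti bracket y by metis
    then show ?case using h_bracket bracket by simp
  next
    case subspace
    then show ?case
      by (auto simp: vec.subspace_def w_def h_closed star_add star_scale star_0 herm_simps)
  qed
  then show ?thesis by (simp add: w_def)
qed

end

section \<open>The compact real form of the semisimple part\<close>

context critical_reductive
begin

definition k :: "(complex ^ 'n) set" where
  "k = {x \<in> h. adj (ad \<mu> x) = - ad \<mu> x}"

lemma k_iff_star: "x \<in> k \<longleftrightarrow> x \<in> h \<and> star x = - x"
proof -
  have "adj (ad \<mu> x) = - ad \<mu> x \<longleftrightarrow> star x = - x" if "x \<in> h"
  proof -
    have "star x = - x \<longleftrightarrow> ad \<mu> (star x) = ad \<mu> (- x)"
      using ad_inj_on_h that star(1) h_closed by metis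
    then show ?thesis by (simp add: star(2)[OF that] ad_simps(3)[OF \<mu>])
  qed
  then show ?thesis by (auto simp: k_def)
qed

lemma h_eq_k: "h = {x + \<i> *s y | x y. x \<in> k \<and> y \<in> k}"
proof (intro equalityI subsetI)
  fix x assume x: "x \<in> h"
  \<comment> \<open>Skew and hermitian parts of \<open>x\<close>; the factor \<open>- \<i>/2\<close>
    makes the hermitian part skew because \<open>star\<close> is conjugate linear.\<close>
  let ?y = "(1/2) *s (x - star x)" and ?z = "(- \<i>/2) *s (x + star x)"
  have d: "x - star x \<in> h" "x + star x \<in> h" "star (x - star x) = star x - x" "star (x + star x) = star x + x"
    using x star_add[of x "- star x"] by (simp_all add: h_closed star star_add star_star star_neg)
  have "?y \<in> k" "?z \<in> k"
    unfolding k_iff_star star_scale[OF d(1)] star_scale[OF d(2)] d(3,4)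
    using h_closed(3)[OF d(1), of "1/2"] h_closed(3)[OF d(2), of "- \<i>/2"] by (simp_all add: vec_eq_iff)
  moreover have "x = ?y + \<i> *s ?z"
    by (simp add: vec_eq_iff)
  ultimately show "x \<in> {x + \<i> *s y | x y. x \<in> k \<and> y \<in> k}" by blast
next
  fix x assume "x \<in> {x + \<i> *s y | x y. x \<in> k \<and> y \<in> k}"
  then show "x \<in> h" using h_closed by (auto simp: k_def)
qed

lemma subspace_k: "subspace k"
proof -
  have "adj (ad \<mu> 0) = - ad \<mu> 0" by (simp add: ad_simps(5)[OF \<mu>] adj_simps)
  then show ?thesis
    using subspace_of_vec_subspace[OF vec_subspaces(1)]
    by (simp add: subspace_def k_def ad_simps(1,4)[OF \<mu>] adj_simps)
qed

text \<open>Elements of \<open>k\<close> act as skew-hermitian operators, so the real part of the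
  hermitian product is an invariant inner product.\<close>

lemma compact_k: "compact_subalgebra \<mu> k"
  unfolding compact_subalgebra_def real_subalgebra_def
proof (intro conjI exI[of _ inner] ballI impI subspace_k)
  fix x y assume "x \<in> k" "y \<in> k"
  then show "\<mu> x y \<in> k"
    by (simp add: k_iff_star h_bracket star_bracket br)
next
  show "bilinear (inner :: complex ^ 'n \<Rightarrow> complex ^ 'n \<Rightarrow> real)"
    by (simp add: bilinear_conv_bounded_bilinear bounded_bilinear_inner)
next
  fix x y z :: "complex ^ 'n" assume "x \<in> k"
  then have "herm (\<mu> x y) z = - herm y (\<mu> x z)"
    by (simp add: k_iff_star herm_star(1) br herm_simps)
  then show "inner (\<mu> x y) z = - inner y (\<mu> x z)"
    by (simp flip: Re_herm)
qed (simp_all add: inner_commute)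

text \<open>If \<open>\<i> *s b\<close> lies in a compact algebra containing \<open>k\<close>, where \<open>b \<in> k\<close>, then both \<open>(ad b)\<^sup>2\<close>
  and \<open>(ad (\<i> *s b))\<^sup>2 = - (ad b)\<^sup>2\<close> are negative semidefinite for the invariant inner product on
  \<open>k\<close>, so \<open>b\<close> centralizes \<open>k\<close>.\<close>

lemma maximal_k: "maximal_compact_subalgebra \<mu> k h"
  unfolding maximal_compact_subalgebra_def
proof (intro conjI allI impI compact_k)
  show "k \<subseteq> h" by (auto simp: k_def)
next
  fix k' assume *: "compact_subalgebra \<mu> k' \<and> k \<subseteq> k' \<and> k' \<subseteq> h"
  then have compact: "compact_subalgebra \<mu> k'" and sub: "k \<subseteq> k'" "k' \<subseteq> h" by auto
  have k': "subspace k'" "\<And>x y. x \<in> k' \<Longrightarrow> y \<in> k' \<Longrightarrow> \<mu> x y \<in> k'"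
    using compact by (simp_all add: compact_subalgebra_def real_subalgebra_def)
  from compact obtain Q :: "complex ^ 'n \<Rightarrow> complex ^ 'n \<Rightarrow> real" where
    Q_bilinear: "bilinear Q" and Q_pos: "\<forall>x\<in>k'. x \<noteq> 0 \<longrightarrow> Q x x > 0"
    and Q_inv: "\<forall>x\<in>k'. \<forall>y\<in>k'. \<forall>z\<in>k'. Q (\<mu> x y) z = - Q y (\<mu> x z)"
    unfolding compact_subalgebra_def by (elim conjE exE) (rule that)
  have Q: "bilinear Q" "\<And>x. x \<in> k' \<Longrightarrow> x \<noteq> 0 \<Longrightarrow> Q x x > 0"
      "\<And>x y z. x \<in> k' \<Longrightarrow> y \<in> k' \<Longrightarrow> z \<in> k' \<Longrightarrow> Q (\<mu> x y) z = - Q y (\<mu> x z)"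
    using Q_bilinear Q_pos Q_inv by simp_all
  have h_decomp: "\<exists>u v. u \<in> k \<and> v \<in> k \<and> x = u + \<i> *s v" if "x \<in> h" for x
    using that by (subst (asm) h_eq_k) blast
  have "x \<in> k" if x: "x \<in> k'" for x
  proof -
    obtain a' b where ab: "a' \<in> k" "b \<in> k" "x = a' + \<i> *s b"
      using x sub(2) h_decomp[of x] by blast
    then have b': "\<i> *s b \<in> k'"
      using subspace_diff[OF k'(1) x, of a'] sub by auto
    have b: "b \<in> k'" using ab sub by blast
    have comm: "\<mu> b y = 0" if "y \<in> k" for y
    proof -
      have y: "y \<in> k'" using that sub by blast
      have "Q (\<mu> b (\<mu> b y)) y = - Q (\<mu> b y) (\<mu> b y)"
        using Q(3)[OF b k'(2)[OF b y] y] .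
      moreover have "Q (\<mu> (\<i> *s b) (\<mu> (\<i> *s b) y)) y = - Q (\<mu> (\<i> *s b) y) (\<mu> (\<i> *s b) y)"
        using Q(3)[OF b' k'(2)[OF b' y] y] .
      moreover have "\<mu> (\<i> *s b) (\<mu> (\<i> *s b) y) = - \<mu> b (\<mu> b y)"
        by (simp add: br)
      moreover have "Q (- \<mu> b (\<mu> b y)) y = - Q (\<mu> b (\<mu> b y)) y"
        using Q(1) by (rule bilinear_lneg)
      \<comment> \<open>Adding the two invariance identities cancels the terms with
        \<open>\<mu> b (\<mu> b y)\<close>.\<close>
      ultimately have "Q (\<mu> b y) (\<mu> b y) + Q (\<mu> (\<i> *s b) y) (\<mu> (\<i> *s b) y) = 0"
        by simp
      moreover have "Q (\<mu> (\<i> *s b) y) (\<mu> (\<i> *s b) y) \<ge> 0"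
        using Q(2)[OF k'(2)[OF b' y]] bilinear_lzero[OF Q(1), of 0]
        by (cases "\<mu> (\<i> *s b) y = 0") simp_all
      ultimately show ?thesis
        using Q(2)[OF k'(2)[OF b y]] by (cases "\<mu> b y = 0") simp_all
    qed
    \<comment> \<open>Commuting with \<open>k\<close> extends to \<open>h\<close> by complex
      linearity and to \<open>g\<close> because \<open>a\<close> is central; then \<open>b\<close>
      lies in \<open>h \<inter> a\<close>.\<close>
    have "\<mu> b y = 0" if y: "y \<in> h" for y
    proof -
      obtain u v where "u \<in> k" "v \<in> k" "y = u + \<i> *s v" using h_decomp[OF y] by blast
      then show ?thesis using comm by (simp add: br)
    qed
    moreover have "b \<in> h" using ab by (simp add: k_def)
    ultimately have "\<mu> b y = 0" if y: "y \<in> g" for y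
    proof -
      obtain u v where "u \<in> h" "v \<in> a" "y = u + v" using y unfolding g_eq by blast
      then show ?thesis using \<open>\<And>y. y \<in> h \<Longrightarrow> \<mu> b y = 0\<close> a_central(2)[OF _ h_g[OF \<open>b \<in> h\<close>]]
        by (simp add: br)
    qed
    then have "b \<in> a" using h_g[OF \<open>b \<in> h\<close>] by (simp add: a_def center_def)
    then have "b \<in> h \<inter> a" using \<open>b \<in> h\<close> by blast
    then show ?thesis using ab unfolding h_a by simp
  qed
  then show "k' = k" using sub by blast
qed

section \<open>The second sum in \<open>M_op\<close> as a trace over the semisimple part\<close>

context
  fixes P assumes P: "is_projection P h"
begin

lemma P_props: "adj P = P" "P *v x \<in> h" "x \<in> h \<Longrightarrow> P *v x = x"
  using P by (auto simp: is_projection_def)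

lemma herm_P: "herm (P *v x) y = herm x (P *v y)" "x \<in> h \<Longrightarrow> herm x (P *v y) = herm x y"
  using herm_adj[of P x y] by (simp_all add: P_props)

text \<open>Only the \<open>h\<close>-component of \<open>y\<close> matters: \<open>n\<close>
  absorbs brackets and is orthogonal to \<open>x\<close>, while elements of \<open>a\<close> kill
  \<open>g\<close> and preserve \<open>n\<close>.\<close>

lemma adj_ad_eq_star:
  assumes x: "x \<in> h"
  shows "adj (ad \<mu> y) *v x = - \<mu> x (star (P *v y))"
proof -
  have "herm x (\<mu> (y - P *v y) z) = 0" for z
  proof -
    obtain u w where y: "u \<in> g" "w \<in> n" "y = u + w" by (rule g_n_decomp)
    obtain u1 u2 where u: "u1 \<in> h" "u2 \<in> a" "u = u1 + u2" using y(1) unfolding g_eq by blast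
    obtain z1 z2 where z: "z1 \<in> g" "z2 \<in> n" "z = z1 + z2" by (rule g_n_decomp)
    have "w \<in> orth_compl h" "u2 \<in> orth_compl h"
      using y(2) u(2) orth_n(1) h_g a_orth_h by (auto simp: orth_compl_def)
    then have "P *v w = 0" "P *v u2 = 0" using projection_orth_compl[OF P] by auto
    then have "y - P *v y = u2 + w"
      using y(3) u P_props(3) by (simp add: matrix_vector_right_distrib)
    moreover have "herm x (\<mu> w z) = 0" "herm x (\<mu> u2 z2) = 0"
      using orth_n(2) n_bracket y(2) z(2) h_g[OF x] by blast+
    moreover have "\<mu> u2 z1 = 0" using a_central u(2) z(1) by blast
    ultimately show ?thesis by (simp add: z(3) br herm_simps)
  qed
  then have eq: "herm x (\<mu> y z) = herm x (\<mu> (P *v y) z)" for z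
    by (simp add: br herm_simps)
  have "herm (adj (ad \<mu> y) *v x) z = herm (\<mu> (star (P *v y)) x) z" for z
    using P_props(2) by (simp add: adj_ad(1) eq herm_star(2))
  then have "adj (ad \<mu> y) *v x = \<mu> (star (P *v y)) x" by (rule vec_eqI_herm)
  then show ?thesis by (simp only: br_anti[of "star (P *v y)" x])
qed

lemma herm_star_P:
  assumes "x \<in> h"
  shows "herm x (star (P *v y)) = herm y (star x)"
  using herm_star_symmetric[OF assms P_props(2)] herm_P(1)[of y "star x"] P_props(3) star(1)[OF assms]
  by simp

text \<open>Parseval is applied twice, with the sums interchanged in between so that
  \<open>star\<close> moves from the basis vectors onto the images \<open>?u A j\<close>.\<close>

lemma sum_adj_ad_h:
  assumes A: "A \<in> h" and B: "B \<in> h"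
  shows "(\<Sum>i\<in>UNIV. herm (adj (ad \<mu> (axis i 1)) *v A) (adj (ad \<mu> (axis i 1)) *v B)) =
    trace (ad \<mu> A ** adj (ad \<mu> B) ** P)"
proof -
  let ?e = "\<lambda>i. axis i 1 :: complex ^ 'n"
  let ?J = "\<lambda>i. star (P *v ?e i)"
  let ?u = "\<lambda>A j. P *v (adj (ad \<mu> A) *v ?e j)"
  have J: "herm (\<mu> A (?J i)) (?e j) = herm (star (?u A j)) (?e i)" for A i j
  proof -
    have "herm (\<mu> A (?J i)) (?e j) = herm (?J i) (?u A j)"
      by (simp add: herm_P(2) star(1) P_props(2) adj_ad(2))
    also have "\<dots> = cnj (herm (?u A j) (?J i))" by (simp add: herm_cnj)
    also have "\<dots> = herm (star (?u A j)) (?e i)"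
      by (simp add: herm_star_P P_props(2) herm_cnj)
    finally show ?thesis .
  qed
  have "(\<Sum>i\<in>UNIV. herm (adj (ad \<mu> (?e i)) *v A) (adj (ad \<mu> (?e i)) *v B)) =
      (\<Sum>i\<in>UNIV. herm (\<mu> A (?J i)) (\<mu> B (?J i)))"
    by (simp add: adj_ad_eq_star A B herm_simps)
  also have "\<dots> = (\<Sum>i\<in>UNIV. \<Sum>j\<in>UNIV. herm (\<mu> A (?J i)) (?e j) * cnj (herm (\<mu> B (?J i)) (?e j)))"
    by (simp add: herm_Parseval)
  also have "\<dots> = (\<Sum>j\<in>UNIV. \<Sum>i\<in>UNIV. herm (star (?u A j)) (?e i) * cnj (herm (star (?u B j)) (?e i)))"
    unfolding J by (rule sum.swap)
  also have "\<dots> = (\<Sum>j\<in>UNIV. herm (star (?u A j)) (star (?u B j)))"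
    by (simp add: herm_Parseval)
  \<comment> \<open>Symmetry of the form together with \<open>star_star\<close> says that
    \<open>star\<close> is antiunitary on \<open>h\<close>.\<close>
  also have "\<dots> = (\<Sum>j\<in>UNIV. herm (?u B j) (?u A j))"
    by (simp add: herm_star_symmetric[OF star(1)] P_props(2) star_star)
  also have "\<dots> = (\<Sum>j\<in>UNIV. herm ((ad \<mu> A ** P ** adj (ad \<mu> B)) *v ?e j) (?e j))"
    by (simp add: P_props herm_adj_right flip: matrix_vector_mul_assoc)
  also have "\<dots> = trace (ad \<mu> A ** (P ** adj (ad \<mu> B)))"
    by (simp add: trace_eq_herm matrix_mul_assoc)
  also have "P ** adj (ad \<mu> B) = adj (ad \<mu> B) ** P"
    by (rule projection_commute[OF P]) (simp_all add: ad_app adj_ad_h ad_h h_g B)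
  finally show ?thesis by (simp add: matrix_mul_assoc)
qed

text \<open>Both sides see only the \<open>h\<close>-components: every
  \<open>adj (ad \<mu> x)\<close> kills \<open>a\<close>, adjoints coming from \<open>a\<close> kill
  \<open>h\<close>, and \<open>a\<close> acts by zero on \<open>g\<close>.\<close>

lemma sum_adj_ad_g:
  assumes A: "A \<in> g" and B: "B \<in> g"
  shows "(\<Sum>i\<in>UNIV. herm (adj (ad \<mu> (axis i 1)) *v A) (adj (ad \<mu> (axis i 1)) *v B)) =
    trace (ad \<mu> A ** adj (ad \<mu> B) ** P)"
proof -
  obtain A1 A2 where A12: "A1 \<in> h" "A2 \<in> a" "A = A1 + A2" using A unfolding g_eq by blast
  obtain B1 B2 where B12: "B1 \<in> h" "B2 \<in> a" "B = B1 + B2" using B unfolding g_eq by blast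
  have adj_a: "adj (ad \<mu> x) *v y = 0" if "y \<in> a" for x y
    by (rule vec_eqI_herm) (simp add: adj_ad(1) a_orth_bracket that herm_simps)
  have adj_h: "adj (ad \<mu> x) *v y = 0" if "x \<in> a" "y \<in> h" for x y
  proof (rule vec_eqI_herm)
    fix z
    obtain u w where "u \<in> g" "w \<in> n" "z = u + w" by (rule g_n_decomp)
    then show "herm (adj (ad \<mu> x) *v y) z = herm 0 z"
      by (simp add: adj_ad(1) br herm_simps that a_central(1) orth_n(2) n_bracket(2) h_g)
  qed
  have "(ad \<mu> A ** adj (ad \<mu> B) ** P) *v x = (ad \<mu> A1 ** adj (ad \<mu> B1) ** P) *v x" for x
  proof -
    let ?y = "adj (ad \<mu> B1) *v (P *v x)"
    have "?y \<in> g" using B12 P_props h_g by (intro adj_ad_g) auto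
    moreover have "adj (ad \<mu> B) *v (P *v x) = ?y"
      using adj_h[OF B12(2) P_props(2)]
      by (simp add: B12(3) ad_simps(1)[OF \<mu>] adj_simps matrix_vector_mult_add_rdistrib)
    ultimately show ?thesis
      using a_central(1)[OF A12(2)] by (simp add: ad_app A12(3) br flip: matrix_vector_mul_assoc)
  qed
  then have "ad \<mu> A ** adj (ad \<mu> B) ** P = ad \<mu> A1 ** adj (ad \<mu> B1) ** P"
    by (simp add: matrix_eq)
  moreover have "adj (ad \<mu> x) *v A = adj (ad \<mu> x) *v A1" "adj (ad \<mu> x) *v B = adj (ad \<mu> x) *v B1" for x
    using adj_a A12 B12 by (simp_all add: matrix_vector_right_distrib)
  ultimately show ?thesis using sum_adj_ad_h A12(1) B12(1) by simp
qed

end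

text \<open>Antisymmetry exchanges the basis vector with \<open>A\<close> and \<open>B\<close>,
  turning the first sum of \<open>M_op\<close> into a full trace.\<close>

lemma herm_M_op:
  "herm (M_op \<mu> *v A) B = - 4 * trace (ad \<mu> A ** adj (ad \<mu> B)) +
     2 * (\<Sum>i\<in>UNIV. herm (adj (ad \<mu> (axis i 1)) *v A) (adj (ad \<mu> (axis i 1)) *v B))"
proof -
  let ?e = "\<lambda>i. axis i 1 :: complex ^ 'n"
  have sum_mult: "(\<Sum>i\<in>I. f i) *v x = (\<Sum>i\<in>I. f i *v x)" for I f and x :: "complex ^ 'n"
    by (induction I rule: infinite_finite_induct) (simp_all add: matrix_vector_mult_add_rdistrib)
  have "trace (ad \<mu> A ** adj (ad \<mu> B)) = trace (adj (ad \<mu> B) ** ad \<mu> A)" by (rule trace_mul_sym)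
  also have "\<dots> = (\<Sum>i\<in>UNIV. herm (\<mu> A (?e i)) (\<mu> B (?e i)))"
    by (simp add: trace_eq_herm adj_ad(1) ad_app flip: matrix_vector_mul_assoc)
  also have "\<dots> = (\<Sum>i\<in>UNIV. herm (\<mu> (?e i) A) (\<mu> (?e i) B))"
    by (intro sum.cong refl, subst (1 2) br_anti) (simp add: herm_simps)
  finally show ?thesis
    by (simp add: M_op_def matrix_vector_mult_add_rdistrib scaleR_matrix_vector scaleR_vec_complex
      herm_simps sum_mult herm_sum adj_ad(1) adj_ad(2)[symmetric] ad_app matrix_vector_mult_diff_rdistrib flip: matrix_vector_mul_assoc)
qed

text \<open>The space is the orthogonal sum of \<open>h\<close>, \<open>a\<close> and
  \<open>n\<close>, and \<open>a\<close> contributes nothing since \<open>adj (ad \<mu> B)\<close>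
  kills it.\<close>

lemma trace_decomposition:
  assumes P: "is_projection P h" and R: "is_projection R n"
    and A: "A \<in> g" and B: "B \<in> g"
  shows "trace (ad \<mu> A ** adj (ad \<mu> B)) =
    trace (ad \<mu> A ** adj (ad \<mu> B) ** P) + trace (ad \<mu> A ** adj (ad \<mu> B) ** R)"
proof -
  define T where "T = ad \<mu> A ** adj (ad \<mu> B)"
  have "T *v x = T *v (P *v x) + T *v (R *v x)" for x
  proof -
    obtain u w where x: "u \<in> g" "w \<in> n" "x = u + w" by (rule g_n_decomp)
    obtain u1 u2 where u: "u1 \<in> h" "u2 \<in> a" "u = u1 + u2" using x(1) unfolding g_eq by blast
    have "w \<in> orth_compl h" "u2 \<in> orth_compl h" "u1 \<in> orth_compl n" "u2 \<in> orth_compl n"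
      using x(2) u orth_n h_g a_orth_h a_g by (auto simp: orth_compl_def)
    then have "P *v w = 0" "P *v u2 = 0" "R *v u1 = 0" "R *v u2 = 0"
      using projection_orth_compl[OF P] projection_orth_compl[OF R] by auto
    moreover have "P *v u1 = u1" "R *v w = w"
      using P R u x by (auto simp: is_projection_def)
    moreover have "T *v u2 = 0"
      using adj_ad_a[OF B u(2)] by (simp add: T_def flip: matrix_vector_mul_assoc)
    ultimately show ?thesis by (simp add: x(3) u(3) matrix_vector_right_distrib)
  qed
  then have "T = T ** P + T ** R"
    unfolding matrix_eq matrix_vector_mult_add_rdistrib matrix_vector_mul_assoc[symmetric] by blast
  then have "trace T = trace (T ** P + T ** R)" by (rule arg_cong)
  then show ?thesis by (simp add: trace_add T_def)
qed

lemma inner_product_formula: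
  assumes A: "A \<in> g" and B: "B \<in> g"
  shows "\<forall>x\<in>h. (ad \<mu> A ** adj (ad \<mu> B)) *v x \<in> h" "\<forall>x\<in>n. (ad \<mu> A ** adj (ad \<mu> B)) *v x \<in> n"
    "herm A B = - (4 / complex_of_real c) *
       (1 / 2 * trace_on h (ad \<mu> A ** adj (ad \<mu> B)) + trace_on n (ad \<mu> A ** adj (ad \<mu> B)))"
proof -
  let ?T = "ad \<mu> A ** adj (ad \<mu> B)"
  show h: "\<forall>x\<in>h. ?T *v x \<in> h"
    using A B by (simp add: ad_app adj_ad_h ad_h flip: matrix_vector_mul_assoc)
  have "adj (ad \<mu> B) *v x \<in> n" if "x \<in> n" for x
    using orth_n(1)[OF that g_bracket[OF B]] unfolding n_def by (simp add: orth_compl_def adj_ad(1))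
  then show n: "\<forall>x\<in>n. ?T *v x \<in> n"
    by (simp add: ad_app n_bracket flip: matrix_vector_mul_assoc)
  obtain P where P: "is_projection P h" by (rule projection_exists[OF vec_subspaces(1)])
  obtain R where R: "is_projection R n" by (rule projection_exists[OF vec_subspaces(4)])
  have "M_op \<mu> *v A = complex_of_real c *s A"
    using A unfolding M_eq g_def
    by (simp add: matrix_vector_mult_add_rdistrib)
      (simp add: vec_eq_iff matrix_vector_mult_def mat_def if_distrib if_distribR cong: if_cong)
  then have "complex_of_real c * herm A B = - 4 * trace ?T + 2 * trace (?T ** P)"
    using herm_M_op[of A B] sum_adj_ad_g[OF P A B] by (simp add: herm_simps)
  \<comment> \<open>Over \<open>h\<close> the coefficients -4 and 2 combine to -2, the source of the
    factor \<open>1 / 2\<close>.\<close>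
  then have "complex_of_real c * herm A B = - 4 * (1 / 2 * trace (?T ** P) + trace (?T ** R))"
    using trace_decomposition[OF P R A B] by simp
  moreover have "trace_on h ?T = trace (?T ** P)" "trace_on n ?T = trace (?T ** R)"
    using trace_on_eq[OF vec_subspaces(1) P, of ?T] trace_on_eq[OF vec_subspaces(4) R, of ?T] h n by simp_all
  ultimately show "herm A B = - (4 / complex_of_real c) * (1 / 2 * trace_on h ?T + trace_on n ?T)"
    using c_nonzero by (simp add: field_simps)
qed

end

section \<open>The eigenspace decomposition\<close>

text \<open>Eigenvectors of the hermitian \<open>D\<close> for positive eigenvalues are orthogonal
  to the kernel, and together with it they span everything; so a vector orthogonal to the kernel has
  no kernel component.\<close>

lemma orth_compl_kernel:
  fixes D :: "complex ^ 'n::finite ^ 'n"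
  assumes t: "t > 0" and adj_D: "adj D = D"
    and type: "eigenvalue_type (t *\<^sub>R D) ks ds" and k1: "ks ! 0 = 0"
  shows "orth_compl {x. D *v x = 0} =
      vec.span (\<Union>i\<in>{1..<length ks}. eigenspace (t *\<^sub>R D) (of_nat (ks ! i)))" (is "?L = ?R")
    and "vec.span {x. \<exists>r\<ge>0. D *v x = complex_of_real r *s x} = UNIV"
    and "eigenspace (t *\<^sub>R D) (of_nat (ks ! 0)) = {x. D *v x = 0}"
    and "\<And>i. i \<in> {1..<length ks} \<Longrightarrow>
      \<exists>r>0. eigenspace (t *\<^sub>R D) (of_nat (ks ! i)) \<subseteq> {x. D *v x = complex_of_real r *s x}"
proof -
  have eig: "T *v x = z *s x \<longleftrightarrow> D *v x = (z / complex_of_real t) *s x"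
    if "T = t *\<^sub>R D" for z x T
    using t unfolding that scaleR_matrix_vector scaleR_vec_complex
    by (auto simp: vec_eq_iff field_simps)
  show g: "eigenspace (t *\<^sub>R D) (of_nat (ks ! 0)) = {x. D *v x = 0}"
    using t by (auto simp: eigenspace_def k1 scaleR_matrix_vector)
  show pos: "\<exists>r>0. eigenspace (t *\<^sub>R D) (of_nat (ks ! i)) \<subseteq> {x. D *v x = complex_of_real r *s x}"
    if i: "i \<in> {1..<length ks}" for i
  proof -
    \<comment> \<open>The list is strictly increasing and starts at 0, so all later eigenvalues are
      positive.\<close>
    have "ks ! 0 < ks ! i"
      using type i sorted_wrt_nth_less[of "(<)" ks 0 i] by (auto simp: eigenvalue_type_def)
    then show ?thesis
      using t by (intro exI[of _ "real (ks ! i) / t"]) (auto simp: eigenspace_def eig)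
  qed
  have ev: "\<exists>i<length ks. x \<in> eigenspace (t *\<^sub>R D) (of_nat (ks ! i)) \<and> D *v x = complex_of_real (real (ks ! i) / t) *s x"
    if "D *v x = z *s x" "x \<noteq> 0" for x z
  proof -
    have "(t *\<^sub>R D) *v x = (of_real t * z) *s x"
      using that by (simp add: scaleR_matrix_vector scaleR_vec_complex)
    moreover from this have "of_real t * z \<in> of_nat ` set ks"
      using type that(2) by (auto simp: eigenvalue_type_def)
    ultimately obtain i where "i < length ks" "(t *\<^sub>R D) *v x = of_nat (ks ! i) *s x"
      by (auto simp: in_set_conv_nth)
    then show ?thesis by (auto simp: eigenspace_def eig)
  qed
  have all: "vec.span {x. \<exists>z. D *v x = z *s x} = UNIV"
    using adj_D by (rule hermitian_span_eigenvectors)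
  show "vec.span {x. \<exists>r\<ge>0. D *v x = complex_of_real r *s x} = UNIV"
  proof -
    have "\<exists>r\<ge>0. D *v x = complex_of_real r *s x" if x: "D *v x = z *s x" for x z
    proof (cases "x = 0")
      case False
      then obtain i where "D *v x = complex_of_real (real (ks ! i) / t) *s x" using ev[OF x] by blast
      then show ?thesis using t by (intro exI[of _ "real (ks ! i) / t"]) simp
    qed auto
    then have "{x. \<exists>z. D *v x = z *s x} \<subseteq> {x. \<exists>r\<ge>0. D *v x = complex_of_real r *s x}" by blast
    then have "vec.span {x. \<exists>z. D *v x = z *s x} \<subseteq> vec.span {x. \<exists>r\<ge>0. D *v x = complex_of_real r *s x}"
      by (rule vec.span_mono)
    then show ?thesis using all by auto
  qed
  let ?g = "{x. D *v x = 0}"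
  have R_L: "?R \<subseteq> ?L"
  proof (rule vec.span_minimal[OF _ subspace_orth_compl], safe)
    fix i x assume "i \<in> {1..<length ks}" "x \<in> eigenspace (t *\<^sub>R D) (of_nat (ks ! i))"
    then obtain r where r: "r > 0" "D *v x = complex_of_real r *s x" using pos by blast
    have "herm x y = 0" if "D *v y = 0" for y
    proof -
      have "complex_of_real r * herm x y = herm x (D *v y)"
        using r by (simp add: herm_adj_right adj_D herm_simps)
      then show ?thesis using r that by (simp add: herm_simps)
    qed
    then show "x \<in> ?L" by (simp add: orth_compl_def)
  qed
  moreover have "?L \<subseteq> ?R"
  proof
    fix x assume x: "x \<in> ?L"
    have "{x. \<exists>z. D *v x = z *s x} \<subseteq> {u + w | u w. u \<in> ?g \<and> w \<in> ?R}"
    proof safe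
      fix y z assume y: "D *v y = z *s y"
      show "\<exists>u w. y = u + w \<and> u \<in> ?g \<and> w \<in> ?R"
      proof (cases "y = 0")
        case True
        then show ?thesis by (intro exI[of _ 0]) (simp add: vec.span_zero)
      next
        case False
        then obtain i where i: "i < length ks" "y \<in> eigenspace (t *\<^sub>R D) (of_nat (ks ! i))"
          using ev[OF y] by blast
        show ?thesis
        proof (cases "i = 0")
          case True
          then show ?thesis using i g by (intro exI[of _ y] exI[of _ 0]) (simp add: vec.span_zero)
        next
          case False
          then have "y \<in> ?R" using i by (intro vec.span_base) auto
          then show ?thesis by (intro exI[of _ 0] exI[of _ y]) simp
        qed
      qed
    qed
    moreover have "vec.subspace {u + w | u w. u \<in> ?g \<and> w \<in> ?R}"
      by (intro vec.subspace_sums vec.subspace_span)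
        (simp add: vec.subspace_def matrix_vector_right_distrib matrix_vector_scale)
    ultimately have "vec.span {x. \<exists>z. D *v x = z *s x} \<subseteq> {u + w | u w. u \<in> ?g \<and> w \<in> ?R}"
      by (rule vec.span_minimal)
    then have "x \<in> {u + w | u w. u \<in> ?g \<and> w \<in> ?R}" unfolding all by (rule subsetD) (rule UNIV_I)
    then obtain u w where uw: "u \<in> ?g" "w \<in> ?R" "x = u + w" by blast
    have "herm x u = 0" "herm w u = 0"
      using orth_complD(1) x uw R_L by blast+
    then have "u = 0" by (simp add: uw(3) herm_simps)
    then show "x \<in> ?R" using uw by simp
  qed
  ultimately show "?L = ?R" by blast
qed

text \<open>A derivation adds eigenvalues under the bracket: a positive plus a nonnegative one is
  positive, so the bracket stays orthogonal to the kernel.\<close>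

lemma bracket_orth_compl_kernel:
  fixes D :: "complex ^ 'n::finite ^ 'n"
  assumes \<mu>: "\<mu> \<in> Vn" and D_der: "D \<in> Der \<mu>" and adj_D: "adj D = D"
    and t: "t > 0" and type: "eigenvalue_type (t *\<^sub>R D) ks ds" and k1: "ks ! 0 = 0"
    and x: "x \<in> orth_compl {x. D *v x = 0}"
  shows "\<mu> x y \<in> orth_compl {x. D *v x = 0}" (is "_ \<in> ?n")
proof -
  note ker = orth_compl_kernel[OF t adj_D type k1]
  have sub: "vec.subspace {x. \<forall>y. \<mu> x y \<in> ?n}" "vec.subspace {y. \<mu> x y \<in> ?n}" for x
    using subspace_orth_compl[of "{x. D *v x = 0}"]
    by (auto simp: vec.subspace_def Vn_simps[OF \<mu>])
  have "vec.span (\<Union>i\<in>{1..<length ks}. eigenspace (t *\<^sub>R D) (of_nat (ks ! i))) \<subseteq> {x. \<forall>y. \<mu> x y \<in> ?n}"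
  proof (rule vec.span_minimal[OF _ sub(1)], safe)
    fix i x y assume "i \<in> {1..<length ks}" "x \<in> eigenspace (t *\<^sub>R D) (of_nat (ks ! i))"
    then obtain r where r: "r > 0" "D *v x = complex_of_real r *s x" using ker(4) by blast
    have "{y. \<exists>s\<ge>0. D *v y = complex_of_real s *s y} \<subseteq> {y. \<mu> x y \<in> ?n}"
    proof safe
      fix y s assume s: "s \<ge> 0" "D *v y = complex_of_real s *s y"
      have D\<mu>: "D *v \<mu> x y = complex_of_real (r + s) *s \<mu> x y"
        using D_der r s by (simp add: Der_def Vn_simps[OF \<mu>] vec.scale_left_distrib)
      have "herm (\<mu> x y) z = 0" if "D *v z = 0" for z
      proof -
        have "complex_of_real (r + s) * herm (\<mu> x y) z = herm (\<mu> x y) (D *v z)"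
          by (simp add: herm_adj_right adj_D D\<mu> herm_simps ring_distribs)
        moreover have "complex_of_real (r + s) \<noteq> 0" using r s by (simp del: of_real_add)
        ultimately show ?thesis using that by (simp add: herm_simps)
      qed
      then show "\<mu> x y \<in> ?n" by (simp add: orth_compl_def)
    qed
    then have "vec.span {y. \<exists>s\<ge>0. D *v y = complex_of_real s *s y} \<subseteq> {y. \<mu> x y \<in> ?n}"
      by (rule vec.span_minimal[OF _ sub(2)])
    then show "\<mu> x y \<in> ?n" unfolding ker(2) by blast
  qed
  then show ?thesis using x unfolding ker(1)[symmetric] by blast
qed

text \<open>Membership provides some representative with the properties; they pass to \<mu>, a
  nonzero multiple of it, the Jacobi sum being scaled by \<open>z * z\<close>.\<close>

lemma Lie_classesD:
  assumes "proj_class \<mu> \<in> Lie_classes"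
  shows "\<mu> \<in> Vn" "jacobi \<mu>" "\<mu> \<noteq> (\<lambda>x y. 0)"
proof -
  obtain \<nu> where \<nu>: "proj_class \<mu> = proj_class \<nu>" "\<nu> \<in> Vn" "\<nu> \<noteq> (\<lambda>x y. 0)" "jacobi \<nu>"
    using assms by (auto simp: Lie_classes_def)
  have "\<mu> \<in> proj_class \<mu>"
    unfolding proj_class_def by (rule CollectI, rule exI[of _ 1]) simp
  then obtain z where z: "\<mu> = (\<lambda>x y. z *s \<nu> x y)" "z \<noteq> 0"
    unfolding \<nu>(1) by (auto simp: proj_class_def)
  show "\<mu> \<in> Vn"
  proof (rule VnI)
    fix x y show "\<mu> y x = - \<mu> x y" unfolding z(1) by (subst Vn_antisym[OF \<nu>(2)]) simp
  qed (simp_all add: z Vn_simps[OF \<nu>(2)] vec.scale_right_distrib mult.commute)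
  show "jacobi \<mu>"
    unfolding jacobi_def
  proof (intro allI)
    fix u v w
    have "\<mu> u (\<mu> v w) + \<mu> v (\<mu> w u) + \<mu> w (\<mu> u v) =
        (z * z) *s (\<nu> u (\<nu> v w) + \<nu> v (\<nu> w u) + \<nu> w (\<nu> u v))"
      by (simp add: z(1) Vn_simps(4)[OF \<nu>(2)] vec.scale_right_distrib)
    also have "\<nu> u (\<nu> v w) + \<nu> v (\<nu> w u) + \<nu> w (\<nu> u v) = 0"
      using \<nu>(4) unfolding jacobi_def by blast
    finally show "\<mu> u (\<mu> v w) + \<mu> v (\<mu> w u) + \<mu> w (\<mu> u v) = 0" by simp
  qed
  show "\<mu> \<noteq> (\<lambda>x y. 0)"
    using \<nu>(3) z by (auto simp: fun_eq_iff)
qed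

theorem proposition4p8:
  fixes \<mu> :: "'n::finite bracket"
    and c t :: real
    and D :: "complex ^ 'n ^ 'n"
    and ks ds :: "nat list"
    and \<gg> :: "nat \<Rightarrow> (complex ^ 'n) set"
    and \<nn> \<hh> \<aa> \<kk> :: "(complex ^ 'n) set"
  assumes Lie: "proj_class \<mu> \<in> Lie_classes"
    and critical: "critical_point Fn (proj_class \<mu>)"
    and M_eq: "M_op \<mu> = mat (complex_of_real c) + D"
    and D_der: "D \<in> Der \<mu>"
    and t_pos: "t > 0"
    and type: "eigenvalue_type (t *\<^sub>R D) ks ds"
    and k1: "ks ! 0 = 0"
    and g_def: "\<And>i. \<gg> i = eigenspace (t *\<^sub>R D) (of_nat (ks ! i))"
    and n_def: "\<nn> = vec.span (\<Union>i\<in>{1..<length ks}. \<gg> i)"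
    and h_semisimple: "semisimple \<mu> \<hh>"
    and a_def: "\<aa> = center \<mu> (\<gg> 0)"
    and g1_sum: "\<gg> 0 = {x + y | x y. x \<in> \<hh> \<and> y \<in> \<aa>}"
    and g1_direct: "\<hh> \<inter> \<aa> = {0}"
    and k_def: "\<kk> = {A\<in>\<hh>. adj (ad \<mu> A) = - ad \<mu> A}"
  shows "(\<forall>A\<in>\<aa>. ad \<mu> A ** adj (ad \<mu> A) = adj (ad \<mu> A) ** ad \<mu> A) \<and>
    (maximal_compact_subalgebra \<mu> \<kk> \<hh> \<and>
     \<hh> = {A + \<i> *s B | A B. A \<in> \<kk> \<and> B \<in> \<kk>}) \<and>
    (\<forall>A\<in>\<gg> 0. \<forall>B\<in>\<gg> 0.
       (\<forall>x\<in>\<hh>. (ad \<mu> A ** adj (ad \<mu> B)) *v x \<in> \<hh>) \<and>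
       (\<forall>x\<in>\<nn>. (ad \<mu> A ** adj (ad \<mu> B)) *v x \<in> \<nn>) \<and>
       herm A B = - (4 / complex_of_real c) *
         (1 / 2 * trace_on \<hh> (ad \<mu> A ** adj (ad \<mu> B)) +
          trace_on \<nn> (ad \<mu> A ** adj (ad \<mu> B))))"
proof -
  interpret crit: critical_bracket \<mu> c D
    using Lie_classesD[OF Lie] M_eq D_der by (rule critical_bracket.intro)
  note ker = orth_compl_kernel[OF t_pos crit.adj_D type k1]
  have g0: "\<gg> 0 = {x. D *v x = 0}" unfolding g_def by (rule ker(3))
  interpret red: critical_reductive \<mu> c D \<hh>
  proof
    show "subalgebra \<mu> \<hh>" using h_semisimple by (simp add: semisimple_def)
    show "\<mu> x y \<in> orth_compl {x. D *v x = 0}" if "x \<in> orth_compl {x. D *v x = 0}" for x y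
      using bracket_orth_compl_kernel[OF crit.\<mu> D_der crit.adj_D t_pos type k1 that] .
    show "{x. D *v x = 0} = {x + y | x y. x \<in> \<hh> \<and> y \<in> center \<mu> {x. D *v x = 0}}"
      using g1_sum unfolding a_def g0 .
    show "\<hh> \<inter> center \<mu> {x. D *v x = 0} = {0}"
      using g1_direct unfolding a_def g0 .
  qed
  \<comment> \<open>For \<open>\<nn>\<close> this rests on the span of the higher eigenspaces being
    the orthogonal complement of the kernel of \<open>D\<close>.\<close>
  have eqs: "\<gg> 0 = red.g" "\<aa> = red.a" "\<kk> = red.k" "\<nn> = red.n"
    unfolding red.n_def red.a_def red.g_def red.k_def ker(1) k_def a_def g0 n_def by (simp_all add: g_def)
  show ?thesis
    unfolding eqs
    by (intro conjI ballI red.ad_a_normal red.maximal_k red.h_eq_k red.inner_product_formula(3)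
        red.inner_product_formula(1,2)[rule_format])
qed

end
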